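(* Let $P \subseteq \mathbb{Z}^2\setminus\{(0,0)\}$ be a finite set. The following two statements are equivalent. (1) There exists a $P$-primal non-uniform grid that admits a crossing gate; that is, there exist $\ell,\ell'\ge 1$ and an assignment to each cell $v\in V=\{1,\dots,\ell\}\times\{1,\dots,\ell'\}$ of a neighborhood $N_v\subseteq P$ with $|N_v|=1$, such that some configuration on the resulting grid is a crossing gate. (2) There exists a weighted $P$-grid that admits a crossing gate; that is, there exist $\ell,\ell'\ge 1$ and a finite multiset $N$ of elements of $P$, in which every element of $P$ appears at least once, such that some configuration on the uniform $\ell\times\ell'$ grid with neighborhood $N$ is a crossing gate.
   Context: Sandpile grids. For $\ell,\ell'\ge 1$ let $V=\{1,\dots,\ell\}\times\{1,\dots,\ell'\}$ be the set of cells; the first coordinate increases to the East and the second coordinate increases to the North. The West, East, South and North edges of the grid are the sets of cells with first coordinate $1$, first coordinate $\ell$, second coordinate $1$, second coordinate $\ell'$, respectively; corners are cells lying on two edges of different axes. Each cell $u\in V$ is assigned a neighborhood $N_u$, a finite multiset of elements of $\mathbb{Z}^2\setminus\{(0,0)\}$; $N_u(\delta)$ denotes the multiplicity of $\delta$ in $N_u$, and $|N_u|$ is the total number of elements counted with multiplicity. The grid is uniform (with neighborhood $N$) if $N_u=N$ for all $u\in V$. Dynamics. A configuration is a function $c:V\to\mathbb{N}$ (number of grains in each cell). A cell $u$ is stable in $c$ if $c(u)<|N_u|$ and unstable otherwise; $c$ is stable if all cells are stable. One parallel step is the map $$T(c)(u)=c(u)-|N_u|\,H(c(u)-|N_u|)+\sum_{v\in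 V}N_v(u-v)\,H(c(v)-|N_v|),$$ where $H(x)=1$ if $x\ge 0$ and $H(x)=0$ if $x<0$. That is, each unstable cell $v$ topples, sending $N_v(\delta)$ grains to $v+\delta$ for each $\delta$; grains sent outside $V$ are lost (they go to a sink which never topples). Starting from a configuration $c$, we say that a cell $u$ topples if $u$ is unstable in $T^t(c)$ for some $t\ge 0$. Crossing gate. Let $A,A'$ be two opposite edges of the grid and $B,B'$ be the other two opposite edges (so $\{\{A,A'\},\{B,B'\}\}=\{\{\text{North},\text{South}\},\{\text{West},\text{East}\}\}$; any choice of directions is allowed, e.g. $A=$ North, $A'=$ South, $B=$ West, $B'=$ East). A stable configuration $c$ is a crossing gate (with respect to such $A,A',B,B'$) if there are a non-corner cell $a\in A$, a cell $a'\in A'$, a non-corner cell $b\in B$ and a cell $b'\in B'$ such that: (i) starting from $c$ with one grain added at $a$, the cell $a'$ topples and no cell of $B'$ topples; (ii) starting from $c$ with one grain added at $b$, the cell $b'$ topples and no cell of $A'$ topples. A grid admits a crossing gate if some stable configuration on it is a crossing gate. *)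

theory Defs
  imports "HOL-Library.Multiset" "HOL-Library.Product_Plus"
begin

type_synonym cell = "int \<times> int"

type_synonym neighborhood = "(int \<times> int) multiset"

definition cells :: "nat \<Rightarrow> nat \<Rightarrow> cell set" where
  "cells l l' = {1..int l} \<times> {1..int l'}"

datatype direction = North | South | West | East

fun edge :: "nat \<Rightarrow> nat \<Rightarrow> direction \<Rightarrow> cell set" where
  "edge l l' West = {u \<in> cells l l'. fst u = 1}"
| "edge l l' East = {u \<in> cells l l'. fst u = int l}"
| "edge l l' South = {u \<in> cells l l'. snd u = 1}"
| "edge l l' North = {u \<in> cells l l'. snd u = int l'}"

definition corners :: "nat \<Rightarrow> nat \<Rightarrow> cell set" where
  "corners l l' = (edge l l' North \<union> edge l l' South) \<inter> (edge l l' West \<union> edge l l' East)"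

definition H :: "int \<Rightarrow> nat" where
  "H x = (if x \<ge> 0 then 1 else 0)"

text \<open>
  Configurations and neighborhood assignments are total functions on \<open>int \<times> int\<close>; their values
  outside \<open>cells l l'\<close> are never used. The subtraction on \<open>nat\<close> does not truncate, because
  the factor \<open>H\<close> vanishes unless \<open>size (N u) \<le> c u\<close>.
\<close>

definition step ::
    "nat \<Rightarrow> nat \<Rightarrow> (cell \<Rightarrow> neighborhood) \<Rightarrow> (cell \<Rightarrow> nat) \<Rightarrow> (cell \<Rightarrow> nat)" where
  "step l l' N c = (\<lambda>u. if u \<in> cells l l' then
      c u - size (N u) * H (int (c u) - int (size (N u)))
      + (\<Sum>v\<in>cells l l'. count (N v) (u - v) * H (int (c v) - int (size (N v))))
     else 0)"

definition stable_cell :: "(cell \<Rightarrow> neighborhood) \<Rightarrow> (cell \<Rightarrow> nat) \<Rightarrow> cell \<Rightarrow> bool" where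
  "stable_cell N c u \<longleftrightarrow> c u < size (N u)"

definition stable :: "nat \<Rightarrow> nat \<Rightarrow> (cell \<Rightarrow> neighborhood) \<Rightarrow> (cell \<Rightarrow> nat) \<Rightarrow> bool" where
  "stable l l' N c \<longleftrightarrow> (\<forall>u\<in>cells l l'. stable_cell N c u)"

definition topples ::
    "nat \<Rightarrow> nat \<Rightarrow> (cell \<Rightarrow> neighborhood) \<Rightarrow> (cell \<Rightarrow> nat) \<Rightarrow> cell \<Rightarrow> bool" where
  "topples l l' N c u \<longleftrightarrow> u \<in> cells l l' \<and> (\<exists>t. \<not> stable_cell N ((step l l' N ^^ t) c) u)"

definition add_grain :: "(cell \<Rightarrow> nat) \<Rightarrow> cell \<Rightarrow> (cell \<Rightarrow> nat)" where
  "add_grain c u = c(u := c u + 1)"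

text \<open>
  The four sides are given by their directions rather than as sets of cells, since distinct sides
  can coincide as sets when the grid has width or height 1.
\<close>

definition crossing_gate_wrt ::
    "nat \<Rightarrow> nat \<Rightarrow> (cell \<Rightarrow> neighborhood) \<Rightarrow>
     direction \<Rightarrow> direction \<Rightarrow> direction \<Rightarrow> direction \<Rightarrow> (cell \<Rightarrow> nat) \<Rightarrow> bool" where
  "crossing_gate_wrt l l' N A A' B B' c \<longleftrightarrow>
     stable l l' N c \<and>
     (\<exists>a \<in> edge l l' A - corners l l'. \<exists>a' \<in> edge l l' A'.
      \<exists>b \<in> edge l l' B - corners l l'. \<exists>b' \<in> edge l l' B'.
        topples l l' N (add_grain c a) a' \<and>
        (\<forall>u \<in> edge l l' B'. \<not> topples l l' N (add_grain c a) u) \<and>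
        topples l l' N (add_grain c b) b' \<and>
        (\<forall>u \<in> edge l l' A'. \<not> topples l l' N (add_grain c b) u))"

definition crossing_gate ::
    "nat \<Rightarrow> nat \<Rightarrow> (cell \<Rightarrow> neighborhood) \<Rightarrow> (cell \<Rightarrow> nat) \<Rightarrow> bool" where
  "crossing_gate l l' N c \<longleftrightarrow>
     (\<exists>A A' B B'. {{A, A'}, {B, B'}} = {{North, South}, {West, East}} \<and>
        crossing_gate_wrt l l' N A A' B B' c)"

definition admits_crossing_gate :: "nat \<Rightarrow> nat \<Rightarrow> (cell \<Rightarrow> neighborhood) \<Rightarrow> bool" where
  "admits_crossing_gate l l' N \<longleftrightarrow> (\<exists>c. crossing_gate l l' N c)"

text \<open>As usual in this setting, ``non-uniform'' means ``not necessarily uniform''.\<close>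

definition primal_nonuniform ::
    "(int \<times> int) set \<Rightarrow> nat \<Rightarrow> nat \<Rightarrow> (cell \<Rightarrow> neighborhood) \<Rightarrow> bool" where
  "primal_nonuniform P l l' N \<longleftrightarrow>
     (\<forall>v\<in>cells l l'. set_mset (N v) \<subseteq> P \<and> size (N v) = 1)"

definition weighted_neighborhood :: "(int \<times> int) set \<Rightarrow> neighborhood \<Rightarrow> bool" where
  "weighted_neighborhood P N \<longleftrightarrow> set_mset N \<subseteq> P \<and> (\<forall>p\<in>P. count N p \<ge> 1)"

end

theory Submission
  imports Defs "HOL-Analysis.Fashoda_Theorem"
begin

text \<open>
  Both statements are equivalent to the existence of two disjoint walks with steps in \<open>P\<close>, one from
  \<open>A\<close> to \<open>A'\<close> avoiding \<open>B'\<close> and one from \<open>B\<close> to \<open>B'\<close> avoiding \<open>A'\<close>. In any gate, a cell that topples in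
  the first process but not in the second has a predecessor with the same property, so the cells
  that topple in exactly one process contain such walks; conversely, in a primal grid the neighborhoods
  can be chosen along the walks.

  To obtain a weighted gate from two walks, turn the picture so that they go from West to East and
  from South to North. By Fashoda's theorem a step of one walk meets a step of the other although no
  cell is shared, and integrality yields two vectors of \<open>P\<close> with determinant at least 2 in
  absolute value. The displacements of the walks show that \<open>P\<close> also has two vectors \<open>u\<close>, \<open>v\<close> on different
  sides of the diagonal of the grid, so that combinations of \<open>u\<close> and \<open>v\<close> steer East and North. Choosing \<open>u\<close>
  and \<open>v\<close> closest to the diagonal, either their determinant is at least 2, and two staircases in
  different cosets of their lattice never interact, or they form a lattice basis and, up to a reflection
  and a change of basis, some \<open>p\<close> in \<open>P\<close> jumps over a vertical run of the first staircase. Superincreasing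
  weights make the resulting paths insensitive to each other.
\<close>

section \<open>Determinants of lattice vectors\<close>

text \<open>The walks of a given gate cannot be reused. In a uniform grid a toppling cell fires
  along every vector of \<open>P\<close>, so each path also sends grains to cells of the other one,
  and a vector has the same weight everywhere: a step by a light vector is spoiled wherever a
  heavier vector leads from the other path to its target. Hence the walks only yield arithmetic
  facts about \<open>P\<close>, and new paths are built that use at most three vectors. The bound 2
  is what this needs: either \<open>u\<close> and \<open>v\<close> generate a proper sublattice,
  which leaves room for a second coset, or \<open>p\<close> moves back by at least two columns,
  which clears the column of the other path instead of landing on it. The new paths are bi-infinite
  at first, so that non-interaction can be checked without regard to ends; as they stay near lines
  of different slopes, their end points can then be chosen far from the other path.\<close>

definition wedge :: "cell \<Rightarrow> cell \<Rightarrow> int" where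
  "wedge u v = fst u * snd v - snd u * fst v"

definition lin :: "cell \<Rightarrow> cell \<Rightarrow> int \<Rightarrow> int \<Rightarrow> cell" where
  "lin u v i j = (i * fst u + j * fst v, i * snd u + j * snd v)"

lemma fst_lin [simp]: "fst (lin u v i j) = i * fst u + j * fst v"
  and snd_lin [simp]: "snd (lin u v i j) = i * snd u + j * snd v"
  by (simp_all add: lin_def)

lemma lin_add: "lin u v i j + lin u v i' j' = lin u v (i + i') (j + j')"
  by (simp add: lin_def algebra_simps)

lemma lin_diff: "lin u v i j - lin u v i' j' = lin u v (i - i') (j - j')"
  by (simp add: lin_def algebra_simps)

lemma lin_unit [simp]: "lin u v 1 0 = u" "lin u v 0 1 = v"
  by (simp_all add: lin_def)

lemma wedge_lin_left: "wedge (lin u v i j) x = i * wedge u x + j * wedge v x"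
  and wedge_lin_right: "wedge x (lin u v i j) = i * wedge x u + j * wedge x v"
  by (simp_all add: wedge_def algebra_simps)

lemma wedge_self [simp]: "wedge u u = 0"
  by (simp add: wedge_def)

lemma wedge_swap: "wedge v u = - wedge u v"
  by (simp add: wedge_def)

lemma wedge_diff_right: "wedge x (u - v) = wedge x u - wedge x v"
  by (simp add: wedge_def algebra_simps)

lemma lin_eq_iff:
  assumes "wedge u v \<noteq> 0"
  shows "lin u v i j = lin u v i' j' \<longleftrightarrow> i = i' \<and> j = j'"
proof
  assume eq: "lin u v i j = lin u v i' j'"
  have "i * wedge u v = i' * wedge u v"
    using arg_cong[OF eq, of "\<lambda>x. wedge x v"] by (simp add: wedge_lin_left)
  moreover have "j * wedge u v = j' * wedge u v"
    using arg_cong[OF eq, of "wedge u"] by (simp add: wedge_lin_right)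
  ultimately show "i = i' \<and> j = j'"
    using assms by simp
qed simp

lemma cramer:
  "lin u v (wedge p v) (wedge u p) = (wedge u v * fst p, wedge u v * snd p)"
  by (simp add: lin_def wedge_def algebra_simps)

lemma cramer_unimodular:
  assumes "wedge u v = 1"
  shows "p = lin u v (wedge p v) (wedge u p)"
  by (simp add: cramer assms)

text \<open>In an open half-plane, sorting by angle is sorting by \<open>ra\<close>, the cotangent
  of the angle between \<open>p\<close> and \<open>\<delta>\<close>; its maximum and minimum are
  attained at the two extremal directions. The two conclusions serve the two sides of the diagonal,
  the second one with \<open>- \<delta>\<close> in place of \<open>\<delta>\<close>.\<close>

lemma extremal_in_half_plane:
  assumes "finite R" "R \<noteq> {}" "\<And>p. p \<in> R \<Longrightarrow> wedge p \<delta> > 0"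
  shows "\<exists>u\<in>R. \<forall>p\<in>R. wedge u p \<le> 0" "\<exists>u\<in>R. \<forall>p\<in>R. wedge p u \<le> 0"
proof -
  define dt where "dt p = fst p * fst \<delta> + snd p * snd \<delta>" for p :: cell
  define ra where "ra p = real_of_int (dt p) / real_of_int (wedge p \<delta>)" for p
  have norm_pos: "fst \<delta> * fst \<delta> + snd \<delta> * snd \<delta> > 0"
  proof -
    obtain p where "p \<in> R" using assms(2) by blast
    then have "wedge p \<delta> > 0" by (rule assms(3))
    then have "fst \<delta> \<noteq> 0 \<or> snd \<delta> \<noteq> 0" by (auto simp: wedge_def)
    then show ?thesis by (metis sum_squares_gt_zero_iff)
  qed
  have cmp: "wedge u p \<le> 0" if "u \<in> R" "p \<in> R" "ra p \<le> ra u" for u p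
  proof -
    have pos: "wedge u \<delta> > 0" "wedge p \<delta> > 0" using assms(3) that by auto
    have "real_of_int (dt p) * real_of_int (wedge u \<delta>) \<le> real_of_int (dt u) * real_of_int (wedge p \<delta>)"
      using that(3) pos by (simp add: ra_def divide_simps split: if_splits)
    then have "dt p * wedge u \<delta> \<le> dt u * wedge p \<delta>"
      by (metis of_int_le_iff of_int_mult)
    \<comment> \<open>Both vectors are expanded in the orthogonal frame formed by
      \<open>\<delta>\<close> and its rotation.\<close>
    moreover have "wedge u p * (fst \<delta> * fst \<delta> + snd \<delta> * snd \<delta>) = dt p * wedge u \<delta> - dt u * wedge p \<delta>"
      by (simp add: wedge_def dt_def algebra_simps)
    ultimately have "wedge u p * (fst \<delta> * fst \<delta> + snd \<delta> * snd \<delta>) \<le> 0" by simp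
    then show ?thesis using norm_pos by (simp add: mult_le_0_iff)
  qed
  have "Max (ra ` R) \<in> ra ` R" "Min (ra ` R) \<in> ra ` R"
    using assms by auto
  then obtain u v where uv: "u \<in> R" "ra u = Max (ra ` R)" "v \<in> R" "ra v = Min (ra ` R)"
    by (metis imageE)
  have "\<forall>p\<in>R. ra p \<le> ra u" "\<forall>p\<in>R. ra v \<le> ra p"
    using uv assms(1) by auto
  then show "\<exists>u\<in>R. \<forall>p\<in>R. wedge u p \<le> 0" "\<exists>u\<in>R. \<forall>p\<in>R. wedge p u \<le> 0"
    using cmp uv by blast+
qed

text \<open>
  The vectors \<open>u\<close> and \<open>v\<close> are the elements of \<open>P\<close> closest in angle to \<open>\<delta>\<close> on either side of it. If
  they form a lattice basis and neither alternative holds, then all coordinates with respect to it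
  are in \<open>{-1, 0, 1}\<close>, and the only determinants of absolute value 2 come from \<open>(-1, -1)\<close> together
  with \<open>(1, -1)\<close> or \<open>(-1, 1)\<close>; then exchanging one basis vector for the latter is enough.
\<close>

lemma ex_crossing_pair:
  assumes fin: "finite P"
    and D: "wedge D1 \<delta> > 0" "wedge \<delta> D2 > 0" "wedge D1 D2 > 0"
    and span: "\<And>x. (\<forall>p\<in>P. wedge x p \<le> 0) \<Longrightarrow> wedge x D1 \<le> 0 \<and> wedge x D2 \<le> 0"
    and generic: "\<And>p. p \<in> P \<Longrightarrow> wedge p \<delta> \<noteq> 0"
    and big: "p0 \<in> P" "q0 \<in> P" "\<bar>wedge p0 q0\<bar> \<ge> 2"
  shows "\<exists>u\<in>P. \<exists>v\<in>P. wedge u \<delta> > 0 \<and> wedge \<delta> v > 0 \<and>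
    (wedge u v \<ge> 2 \<or> wedge u v = 1 \<and> (\<exists>p\<in>P. wedge p v \<le> -2 \<or> wedge u p \<le> -2))"
proof -
  define R where "R = {p \<in> P. wedge p \<delta> > 0}"
  define L where "L = {p \<in> P. wedge \<delta> p > 0}"
  have PRL: "p \<in> R \<or> p \<in> L" if "p \<in> P" for p
    using generic[OF that] that wedge_swap[of p \<delta>] by (auto simp: R_def L_def)
  have Rne: "R \<noteq> {}"
  proof
    assume "R = {}"
    then have "\<forall>p\<in>P. wedge (- \<delta>) p \<le> 0"
      by (auto simp: R_def wedge_def not_less algebra_simps)
    then have "wedge (- \<delta>) D1 \<le> 0" using span by blast
    then show False using D(1) by (simp add: wedge_def algebra_simps)
  qed
  have finR: "finite R" "finite L" using fin by (simp_all add: R_def L_def)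
  have "\<And>p. p \<in> R \<Longrightarrow> wedge p \<delta> > 0" by (simp add: R_def)
  from extremal_in_half_plane(1)[OF finR(1) Rne this]
  obtain u where u: "u \<in> R" "\<And>p. p \<in> R \<Longrightarrow> wedge u p \<le> 0" by blast
  have u\<delta>: "wedge u \<delta> > 0" "u \<in> P" using u by (auto simp: R_def)
  \<comment> \<open>\<open>\<delta>\<close> is a positive combination of \<open>D1\<close> and
    \<open>D2\<close>. If all of \<open>P\<close> were clockwise of \<open>u\<close>, then by
    \<open>span\<close> so would be \<open>D1\<close>, \<open>D2\<close> and hence
    \<open>\<delta>\<close>, but \<open>wedge u \<delta> > 0\<close>.\<close>
  obtain v0 where v0: "v0 \<in> P" "wedge u v0 > 0"
  proof (rule ccontr)
    assume "\<not> thesis"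
    then have "\<forall>p\<in>P. wedge u p \<le> 0" using that by (meson not_le)
    then have "wedge u D1 \<le> 0" "wedge u D2 \<le> 0" using span by auto
    moreover have "wedge u \<delta> * wedge D1 D2 = wedge u D1 * wedge \<delta> D2 + wedge u D2 * wedge D1 \<delta>"
      by (simp add: wedge_def algebra_simps)
    ultimately have "wedge u \<delta> * wedge D1 D2 \<le> 0"
      using D by (simp add: add_nonpos_nonpos mult_nonpos_nonneg)
    then show False using u\<delta> D(3) by (simp add: mult_le_0_iff)
  qed
  have v0L: "v0 \<in> L" using PRL[OF v0(1)] u(2)[of v0] v0(2) by auto
  obtain v where v: "v \<in> L" "\<And>p. p \<in> L \<Longrightarrow> wedge p v \<le> 0"
  proof -
    have "\<And>p. p \<in> L \<Longrightarrow> wedge p (- \<delta>) > 0" by (auto simp: L_def wedge_def algebra_simps)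
    from extremal_in_half_plane(2)[OF finR(2) _ this] v0L that show thesis by blast
  qed
  have v\<delta>: "wedge \<delta> v > 0" "v \<in> P" using v by (auto simp: L_def)
  \<comment> \<open>The three-term relation between the determinants of four plane vectors.\<close>
  have uv: "wedge u v > 0"
  proof -
    have "wedge u v * wedge \<delta> v0 = wedge u \<delta> * (- wedge v0 v) + wedge u v0 * wedge \<delta> v"
      by (simp add: wedge_def algebra_simps)
    also have "\<dots> > 0"
      using u\<delta> v\<delta> v0 v(2)[OF v0L] by (intro add_nonneg_pos mult_nonneg_nonneg mult_pos_pos) auto
    finally show ?thesis using v0L by (simp add: L_def zero_less_mult_iff)
  qed
  show ?thesis
  proof (rule ccontr)
    assume neg: "\<not> ?thesis"
    then have neg': "\<not> (wedge a \<delta> > 0 \<and> wedge \<delta> b > 0 \<and>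
        (wedge a b \<ge> 2 \<or> wedge a b = 1 \<and> (wedge p b \<le> -2 \<or> wedge a p \<le> -2)))"
      if "a \<in> P" "b \<in> P" "p \<in> P" for a b p using that by blast
    have uv1: "wedge u v = 1" using neg'[of u v u] u\<delta> v\<delta> uv by auto
    \<comment> \<open>In the basis \<open>u\<close>, \<open>v\<close> the coordinates of
      \<open>p\<close> are \<open>wedge p v\<close> and \<open>wedge u p\<close>. The failure of the
      pair \<open>u\<close>, \<open>v\<close> bounds them below; the failure of \<open>p\<close>,
      \<open>v\<close> or of \<open>u\<close>, \<open>p\<close> as a pair bounds them above.\<close>
    have ge: "wedge p v \<ge> -1" "wedge u p \<ge> -1" if "p \<in> P" for p
      using neg'[of u v p] that u\<delta> v\<delta> uv1 by auto
    have inR: "wedge u p \<le> 0 \<and> wedge p v \<le> 1" if "p \<in> R" for p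
      using neg'[of p v p] that v\<delta> u(2)[of p] by (auto simp: R_def)
    have inL: "wedge p v \<le> 0 \<and> wedge u p \<le> 1" if "p \<in> L" for p
      using neg'[of u p p] that u\<delta> v(2)[of p] by (auto simp: L_def)
    have wpq: "wedge p q = wedge p v * wedge u q - wedge u p * wedge q v" for p q
    proof -
      have "wedge u v * wedge p q = wedge p v * wedge u q - wedge u p * wedge q v"
        by (simp add: wedge_def algebra_simps)
      then show ?thesis using uv1 by simp
    qed
    have small: "wedge p v \<in> {-1, 0, 1} \<and> wedge u p \<in> {-1, 0, 1} \<and> \<not> (wedge p v = 1 \<and> wedge u p = 1)"
      if "p \<in> P" for p
      using PRL[OF that] inR[of p] inL[of p] ge[OF that] by auto
    have "\<exists>p\<in>P. \<exists>q\<in>P. wedge q v = -1 \<and> wedge u q = -1 \<and>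
      (wedge p v = 1 \<and> wedge u p = -1 \<or> wedge p v = -1 \<and> wedge u p = 1)"
      using small[OF big(1)] small[OF big(2)] big wpq[of p0 q0] by auto
    then obtain p q where pq: "p \<in> P" "q \<in> P" "wedge q v = -1" "wedge u q = -1"
      "wedge p v = 1 \<and> wedge u p = -1 \<or> wedge p v = -1 \<and> wedge u p = 1" by blast
    from pq(5) show False
    proof
      assume *: "wedge p v = 1 \<and> wedge u p = -1"
      then have "p \<in> R" using PRL[OF pq(1)] inL[of p] by auto
      moreover have "wedge p q = -2" using wpq[of p q] pq * by simp
      ultimately show False using neg'[of p v q] pq * v\<delta> by (simp add: R_def)
    next
      assume *: "wedge p v = -1 \<and> wedge u p = 1"
      then have "p \<in> L" using PRL[OF pq(1)] inR[of p] by auto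
      moreover have "wedge q p = -2" using wpq[of q p] pq * by simp
      ultimately show False using neg'[of u p q] pq * u\<delta> by (simp add: L_def)
    qed
  qed
qed

text \<open>A multiple of \<open>\<delta>\<close> is a positive combination of \<open>u\<close> and
  \<open>v\<close>. A large multiple with one more \<open>u\<close> is slightly flatter than
  \<open>\<delta>\<close>, with one more \<open>v\<close> slightly steeper; rescaling these two
  makes the flat one wider and the steep one taller.\<close>

lemma ex_steering:
  assumes "fst \<delta> > 0" "snd \<delta> > 0" "wedge u \<delta> > 0" "wedge \<delta> v > 0" "wedge u v > 0"
  shows "\<exists>\<alpha> \<beta> \<alpha>' \<beta>'. \<alpha> > 0 \<and> \<beta> > 0 \<and> \<alpha>' > 0 \<and> \<beta>' > 0 \<and>
    0 < fst (lin u v \<alpha>' \<beta>') \<and> fst (lin u v \<alpha>' \<beta>') < fst (lin u v \<alpha> \<beta>) \<and>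
    0 < snd (lin u v \<alpha> \<beta>) \<and> snd (lin u v \<alpha> \<beta>) < snd (lin u v \<alpha>' \<beta>')"
proof -
  define k where "k = 1 + \<bar>fst u\<bar> + \<bar>snd u\<bar> + \<bar>fst v\<bar> + \<bar>snd v\<bar>"
  define a where "a = wedge \<delta> v"
  define b where "b = wedge u \<delta>"
  define w where "w = fst \<delta>"
  define h where "h = snd \<delta>"
  define X1 where "X1 = k * (wedge u v * w) + fst u"
  define Y1 where "Y1 = k * (wedge u v * h) + snd u"
  define X2 where "X2 = k * (wedge u v * w) + fst v"
  define Y2 where "Y2 = k * (wedge u v * h) + snd v"
  have k0: "k > 0" using assms(5) by (auto simp: k_def wedge_def)
  have wh: "w > 0" "h > 0" using assms by (simp_all add: w_def h_def)
  have "wedge u v * w \<ge> 1" "wedge u v * h \<ge> 1"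
    using assms(5) wh by (simp_all add: int_one_le_iff_zero_less)
  then have "k * (wedge u v * w) \<ge> k * 1" "k * (wedge u v * h) \<ge> k * 1"
    using k0 by (intro mult_left_mono; simp)+
  moreover have "k + fst u > 0" "k + snd u > 0" "k + fst v > 0" "k + snd v > 0"
    by (simp_all add: k_def)
  ultimately have pos: "X1 > 0" "Y1 > 0" "X2 > 0" "Y2 > 0"
    unfolding X1_def X2_def Y1_def Y2_def by linarith+
  have slope1: "Y1 * w < X1 * h"
    using assms(3) by (simp add: X1_def Y1_def w_def h_def wedge_def algebra_simps)
  have slope2: "X2 * h < Y2 * w"
    using assms(4) by (simp add: X2_def Y2_def w_def h_def wedge_def algebra_simps)
  have e: "a * fst u + b * fst v = wedge u v * w" "a * snd u + b * snd v = wedge u v * h"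
    by (simp_all add: a_def b_def w_def h_def wedge_def algebra_simps)
  have ab: "a > 0" "b > 0" using assms by (simp_all add: a_def b_def)
  have comb: "lin u v (l * (k * a + c)) (l * (k * b + d)) =
      (l * (k * (wedge u v * w) + c * fst u + d * fst v), l * (k * (wedge u v * h) + c * snd u + d * snd v))" for l c d
    unfolding e[symmetric] by (simp add: lin_def algebra_simps)
  have pos': "w * Y2 > 0" "h * X1 > 0" using pos wh by simp_all
  \<comment> \<open>With these scaling factors the two required inequalities are
    \<open>slope2\<close> times \<open>X1\<close> and \<open>slope1\<close> times
    \<open>Y2\<close>.\<close>
  have "lin u v (w * Y2 * (k * a + 1)) (w * Y2 * (k * b + 0)) = (w * Y2 * X1, w * Y2 * Y1)"
    "lin u v (h * X1 * (k * a + 0)) (h * X1 * (k * b + 1)) = (h * X1 * X2, h * X1 * Y2)"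
    unfolding comb by (simp_all add: X1_def X2_def Y1_def Y2_def)
  moreover have "h * X1 * X2 < w * Y2 * X1" "w * Y2 * Y1 < h * X1 * Y2"
    using mult_strict_left_mono[OF slope2, of X1] mult_strict_left_mono[OF slope1, of Y2] pos
    by (simp_all add: mult_ac)
  moreover have "h * X1 * X2 > 0" "w * Y2 * Y1 > 0" using pos' pos by simp_all
  moreover have "k * a > 0" "k * b > 0" using ab k0 by simp_all
  then have "w * Y2 * (k * a + 1) > 0" "w * Y2 * (k * b + 0) > 0"
    "h * X1 * (k * a + 0) > 0" "h * X1 * (k * b + 1) > 0"
    using mult_pos_pos[OF pos'(1)] mult_pos_pos[OF pos'(2)] by simp_all
  ultimately show ?thesis
    by (metis fst_conv snd_conv)
qed

section \<open>Non-interacting tracks\<close>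

text \<open>
  The weights ensure that a cell that only misses the grains of its predecessor on \<open>X\<close> is not
  triggered by topplings in \<open>B\<close>; the last conjunct ensures that an empty cell is not triggered by
  topplings on \<open>X\<close>.
\<close>

definition track :: "cell set \<Rightarrow> (cell \<Rightarrow> nat) \<Rightarrow> (int \<Rightarrow> cell) \<Rightarrow> cell set \<Rightarrow> bool" where
  "track P w X B \<longleftrightarrow> inj X \<and> range X \<inter> B = {} \<and>
     (\<forall>k. X (k + 1) - X k \<in> P \<and>
        (\<Sum>r | r \<in> P \<and> X (k + 1) - r \<in> B. w r) < w (X (k + 1) - X k)) \<and>
     (\<forall>z. \<exists>r\<in>P. z - r \<notin> range X)"

text \<open>The cell at time \<open>k\<close> stays within bounded distance of \<open>k / L\<close>
  times \<open>D\<close>; clearing the denominator keeps everything integral.\<close>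

definition follows :: "(int \<Rightarrow> cell) \<Rightarrow> int \<Rightarrow> cell \<Rightarrow> bool" where
  "follows X L D \<longleftrightarrow>
     (\<exists>C. \<forall>k. \<bar>L * fst (X k) - k * fst D\<bar> \<le> C \<and> \<bar>L * snd (X k) - k * snd D\<bar> \<le> C)"

definition tracks_cross :: "cell set \<Rightarrow> (cell \<Rightarrow> nat) \<Rightarrow> int \<Rightarrow> cell \<Rightarrow> int \<Rightarrow> cell \<Rightarrow> bool" where
  "tracks_cross P w L D L' D' \<longleftrightarrow> (\<forall>r\<in>P. w r \<ge> 1) \<and>
     (\<exists>X Y. track P w X (range Y) \<and> track P w Y (range X) \<and> follows X L D \<and> follows Y L' D')"

text \<open>
  The cell \<open>lin u v (stair \<alpha> L k) (k - stair \<alpha> L k)\<close> is reached after \<open>k\<close> steps \<open>u\<close> or \<open>v\<close> and stays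
  close to the line of direction \<open>lin u v \<alpha> (L - \<alpha>)\<close>.
\<close>

definition stair :: "int \<Rightarrow> int \<Rightarrow> int \<Rightarrow> int" where
  "stair \<alpha> L k = (\<alpha> * k) div L"

lemma stair_0 [simp]: "stair \<alpha> L 0 = 0"
  by (simp add: stair_def)

lemma stair_mod: "\<alpha> * k - L * stair \<alpha> L k = (\<alpha> * k) mod L"
  by (simp add: stair_def minus_mult_div_eq_mod)

lemma stair_bounds:
  assumes "L > 0"
  shows "0 \<le> \<alpha> * k - L * stair \<alpha> L k" "\<alpha> * k - L * stair \<alpha> L k < L"
  using assms by (simp_all add: stair_mod)

lemma stair_step:
  assumes "0 < \<alpha>" "\<alpha> < L"
  shows "stair \<alpha> L (k + 1) = stair \<alpha> L k \<or> stair \<alpha> L (k + 1) = stair \<alpha> L k + 1"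
proof -
  have "stair \<alpha> L k \<le> stair \<alpha> L (k + 1)"
    using assms by (auto simp: stair_def intro!: zdiv_mono1)
  moreover have "stair \<alpha> L (k + 1) \<le> (\<alpha> * k + L) div L"
    unfolding stair_def using assms by (intro zdiv_mono1) (auto simp: algebra_simps)
  then have "stair \<alpha> L (k + 1) \<le> stair \<alpha> L k + 1"
    using assms by (simp add: stair_def)
  ultimately show ?thesis by linarith
qed

lemma stair_nonpos:
  assumes "0 < \<alpha>" "\<alpha> < L" "k \<le> 0"
  shows "stair \<alpha> L k \<le> 0" "k \<le> stair \<alpha> L k"
proof -
  have "\<alpha> * k \<le> 0" using assms by (simp add: mult_nonneg_nonpos)
  then show "stair \<alpha> L k \<le> 0"
    using assms by (metis stair_def div_nonpos_pos_le0 order.strict_trans order_refl)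
  have "L * k \<le> \<alpha> * k" using assms by (simp add: mult_right_mono_neg)
  then have "(L * k) div L \<le> stair \<alpha> L k"
    unfolding stair_def using assms by (intro zdiv_mono1) auto
  then show "k \<le> stair \<alpha> L k" using assms by simp
qed

lemma stair_nonneg:
  assumes "0 < \<alpha>" "\<alpha> < L" "k \<ge> 0"
  shows "0 \<le> stair \<alpha> L k" "stair \<alpha> L k \<le> k"
proof -
  show "0 \<le> stair \<alpha> L k"
    using assms by (simp add: stair_def pos_imp_zdiv_nonneg_iff)
  have "\<alpha> * k \<le> L * k" using assms by (simp add: mult_right_mono)
  then have "stair \<alpha> L k \<le> (L * k) div L"
    unfolding stair_def using assms by (intro zdiv_mono1) auto
  then show "stair \<alpha> L k \<le> k" using assms by simp
qed

lemma follows_lin: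
  assumes "\<And>k. \<bar>(\<alpha> + \<beta>) * i k - \<alpha> * k\<bar> \<le> C" "\<And>k. \<bar>(\<alpha> + \<beta>) * j k - \<beta> * k\<bar> \<le> C"
  shows "follows (\<lambda>k. t + lin u v (i k) (j k)) (\<alpha> + \<beta>) (lin u v \<alpha> \<beta>)"
proof -
  have bd: "\<bar>L * (t0 + (x * u0 + y * v0)) - k * (\<alpha> * u0 + \<beta> * v0)\<bar> \<le> \<bar>L\<bar> * \<bar>t0\<bar> + C * \<bar>u0\<bar> + C * \<bar>v0\<bar>"
    if "\<bar>L * x - \<alpha> * k\<bar> \<le> C" "\<bar>L * y - \<beta> * k\<bar> \<le> C" for L t0 x y u0 v0 k
  proof -
    have "L * (t0 + (x * u0 + y * v0)) - k * (\<alpha> * u0 + \<beta> * v0) =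
      L * t0 + ((L * x - \<alpha> * k) * u0 + (L * y - \<beta> * k) * v0)"
      by (simp add: algebra_simps)
    also have "\<bar>\<dots>\<bar> \<le> \<bar>L * t0\<bar> + (\<bar>(L * x - \<alpha> * k) * u0\<bar> + \<bar>(L * y - \<beta> * k) * v0\<bar>)"
      by (meson abs_triangle_ineq add_left_mono order_trans)
    also have "\<dots> \<le> \<bar>L\<bar> * \<bar>t0\<bar> + (C * \<bar>u0\<bar> + C * \<bar>v0\<bar>)"
      using that by (intro add_mono) (auto simp: abs_mult intro!: mult_right_mono)
    finally show ?thesis by simp
  qed
  define L where "L = \<alpha> + \<beta>"
  define B where "B x = \<bar>L\<bar> * \<bar>x t\<bar> + C * \<bar>x u\<bar> + C * \<bar>x v\<bar>" for x :: "cell \<Rightarrow> int"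
  have "\<bar>L * fst (t + lin u v (i k) (j k)) - k * fst (lin u v \<alpha> \<beta>)\<bar> \<le> max (B fst) (B snd)" for k
    using bd[of L "i k" k "j k" "fst t" "fst u" "fst v"] assms[of k]
    by (intro max.coboundedI1) (simp add: L_def B_def)
  moreover have "\<bar>L * snd (t + lin u v (i k) (j k)) - k * snd (lin u v \<alpha> \<beta>)\<bar> \<le> max (B fst) (B snd)" for k
    using bd[of L "i k" k "j k" "snd t" "snd u" "snd v"] assms[of k]
    by (intro max.coboundedI2) (simp add: L_def B_def)
  ultimately show ?thesis
    unfolding follows_def L_def by blast
qed

lemma follows_lin_stair:
  assumes "\<alpha> > 0" "\<beta> > 0"
  shows "follows (\<lambda>k. t + lin u v (stair \<alpha> (\<alpha> + \<beta>) k) (k - stair \<alpha> (\<alpha> + \<beta>) k)) (\<alpha> + \<beta>) (lin u v \<alpha> \<beta>)"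
proof (rule follows_lin)
  fix k
  show "\<bar>(\<alpha> + \<beta>) * stair \<alpha> (\<alpha> + \<beta>) k - \<alpha> * k\<bar> \<le> \<alpha> + \<beta>"
    using stair_bounds[of "\<alpha> + \<beta>" \<alpha> k] assms by linarith
  moreover have "(\<alpha> + \<beta>) * (k - stair \<alpha> (\<alpha> + \<beta>) k) - \<beta> * k = - ((\<alpha> + \<beta>) * stair \<alpha> (\<alpha> + \<beta>) k - \<alpha> * k)"
    by (simp add: algebra_simps)
  ultimately show "\<bar>(\<alpha> + \<beta>) * (k - stair \<alpha> (\<alpha> + \<beta>) k) - \<beta> * k\<bar> \<le> \<alpha> + \<beta>"
    by linarith
qed

text \<open>If both unit vectors were in the lattice of \<open>u\<close> and \<open>v\<close>, their
  determinant 1 would be a multiple of \<open>wedge u v\<close>.\<close>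

lemma ex_outside_sublattice:
  assumes "\<bar>wedge u v\<bar> \<ge> 2"
  shows "\<exists>t. \<forall>i j. lin u v i j \<noteq> t"
proof (rule ccontr)
  assume "\<not> ?thesis"
  then obtain i j i' j' where "lin u v i j = (1, 0)" "lin u v i' j' = (0, 1)" by metis
  moreover have "wedge (lin u v i j) (lin u v i' j') = (i * j' - j * i') * wedge u v"
    by (simp add: wedge_def algebra_simps)
  ultimately have "(i * j' - j * i') * wedge u v = 1" by (simp add: wedge_def)
  then have "wedge u v dvd 1" by (metis dvd_triv_right)
  then show False using assms by auto
qed

text \<open>The two coordinates at time \<open>k\<close> add up to \<open>k\<close>, whence
  injectivity. Likewise \<open>z - u\<close> and \<open>z - v\<close> have equal coordinate sums, so
  if both were on the path they would be its cell at one and the same time.\<close>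

lemma stair_track:
  assumes uv: "u \<in> P" "v \<in> P" "wedge u v \<noteq> 0"
    and i: "\<And>k. i (k + 1) = i k \<or> i (k + 1) = i k + (1::int)"
  shows "inj (\<lambda>k. t + lin u v (i k) (k - i k))"
    and "(t + lin u v (i (k + 1)) (k + 1 - i (k + 1))) - (t + lin u v (i k) (k - i k)) \<in> {u, v}"
    and "\<exists>r\<in>P. z - r \<notin> range (\<lambda>k. t + lin u v (i k) (k - i k))"
proof -
  show "inj (\<lambda>k. t + lin u v (i k) (k - i k))"
    by (rule injI) (use lin_eq_iff[OF uv(3)] in auto)
  show "(t + lin u v (i (k + 1)) (k + 1 - i (k + 1))) - (t + lin u v (i k) (k - i k)) \<in> {u, v}"
    using i[of k] by (auto simp: lin_diff)
  show "\<exists>r\<in>P. z - r \<notin> range (\<lambda>k. t + lin u v (i k) (k - i k))"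
  proof (rule ccontr)
    assume "\<not> ?thesis"
    then have "z - u \<in> range (\<lambda>k. t + lin u v (i k) (k - i k))"
      "z - v \<in> range (\<lambda>k. t + lin u v (i k) (k - i k))" using uv by auto
    then obtain k l where k: "z - u = t + lin u v (i k) (k - i k)" "z - v = t + lin u v (i l) (l - i l)"
      by blast
    have "t + (lin u v (i k) (k - i k) + lin u v 1 0) = t + (lin u v (i l) (l - i l) + lin u v 0 1)"
      unfolding add.assoc[symmetric] k[symmetric] by simp
    then have "lin u v (i k + 1) (k - i k) = lin u v (i l) (l - i l + 1)"
      unfolding lin_add by simp
    then have "i k + 1 = i l" "k = l"
      using lin_eq_iff[OF uv(3)] by auto
    then show False by simp
  qed
qed

text \<open>
  The two tracks lie in different cosets of the lattice of \<open>u\<close> and \<open>v\<close>, and \<open>u\<close> and \<open>v\<close> each outweigh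
  the sum of all other vectors.
\<close>

lemma tracks_cross_sublattice:
  assumes "finite P" "u \<in> P" "v \<in> P" "wedge u v \<ge> 2"
    and pos: "\<alpha> > 0" "\<beta> > 0" "\<alpha>' > 0" "\<beta>' > 0"
  shows "\<exists>w. tracks_cross P w (\<alpha> + \<beta>) (lin u v \<alpha> \<beta>) (\<alpha>' + \<beta>') (lin u v \<alpha>' \<beta>')"
proof -
  obtain t where t: "\<And>i j. lin u v i j \<noteq> t"
    using ex_outside_sublattice[of u v] assms(4) by auto
  define i where "i = stair \<alpha> (\<alpha> + \<beta>)"
  define i' where "i' = stair \<alpha>' (\<alpha>' + \<beta>')"
  define X where "X k = 0 + lin u v (i k) (k - i k)" for k
  define Y where "Y k = t + lin u v (i' k) (k - i' k)" for k
  \<comment> \<open>At most \<open>card P - 2\<close> vectors of weight 1 remain, so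
    \<open>card P\<close> exceeds their total.\<close>
  define w where "w r = (if r \<in> {u, v} then card P else 1)" for r
  have ne: "wedge u v \<noteq> 0" "u \<noteq> v" using assms(4) by auto
  have istep: "i (k + 1) = i k \<or> i (k + 1) = i k + 1" "i' (k + 1) = i' k \<or> i' (k + 1) = i' k + 1" for k
    unfolding i_def i'_def using stair_step[of \<alpha> "\<alpha> + \<beta>" k] stair_step[of \<alpha>' "\<alpha>' + \<beta>'" k] pos by auto
  note sc = stair_track[where i = i and t = 0, OF assms(2,3) ne(1) istep(1), folded X_def]
  note sc' = stair_track[where i = i' and t = t, OF assms(2,3) ne(1) istep(2), folded Y_def]
  have off: "X k - lin u v a b \<noteq> Y l" for k l a b
  proof
    assume "X k - lin u v a b = Y l"
    then have "t = lin u v (i k) (k - i k) - lin u v a b - lin u v (i' l) (l - i' l)"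
      by (simp add: X_def Y_def algebra_simps)
    then show False unfolding lin_diff using t by metis
  qed
  have unit: "lin u v 0 0 = 0" "lin u v (-1) 0 = - u" "lin u v 0 (-1) = - v"
    by (simp_all add: lin_def prod_eq_iff)
  have XY: "X k \<noteq> Y l" "X k - u \<noteq> Y l" "X k - v \<noteq> Y l" "Y l - u \<noteq> X k" "Y l - v \<noteq> X k" for k l
    using off[of k 0 0 l] off[of k 1 0 l] off[of k 0 1 l] off[of k "-1" 0 l] off[of k 0 "-1" l]
    by (auto simp: unit diff_eq_eq)
  have light: "(\<Sum>r\<in>S. w r) < card P" if "S \<subseteq> P - {u, v}" for S
  proof -
    have "(\<Sum>r\<in>S. w r) = card S" using that by (subst card_eq_sum, intro sum.cong) (auto simp: w_def)
    also have "\<dots> < card P" using that assms by (intro psubset_card_mono) auto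
    finally show ?thesis .
  qed
  have w1: "\<forall>r\<in>P. w r \<ge> 1"
    using assms by (auto simp: w_def Suc_le_eq card_gt_0_iff)
  have "track P w X (range Y)"
    unfolding track_def
  proof (intro conjI allI)
    fix k
    have e: "X (k + 1) - X k \<in> {u, v}" using sc(2) .
    then show "X (k + 1) - X k \<in> P" using assms by auto
    have "w (X (k + 1) - X k) = card P" using e unfolding w_def by simp
    moreover have "{r. r \<in> P \<and> X (k + 1) - r \<in> range Y} \<subseteq> P - {u, v}"
      using XY by fastforce
    ultimately show "(\<Sum>r | r \<in> P \<and> X (k + 1) - r \<in> range Y. w r) < w (X (k + 1) - X k)"
      using light by simp
  next
    show "range X \<inter> range Y = {}" using XY(1) by (metis disjoint_iff rangeE)
  qed (use sc in auto)
  moreover have "track P w Y (range X)"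
    unfolding track_def
  proof (intro conjI allI)
    fix k
    have e: "Y (k + 1) - Y k \<in> {u, v}" using sc'(2) .
    then show "Y (k + 1) - Y k \<in> P" using assms by auto
    have "w (Y (k + 1) - Y k) = card P" using e unfolding w_def by simp
    moreover have "{r. r \<in> P \<and> Y (k + 1) - r \<in> range X} \<subseteq> P - {u, v}"
      using XY by fastforce
    ultimately show "(\<Sum>r | r \<in> P \<and> Y (k + 1) - r \<in> range X. w r) < w (Y (k + 1) - Y k)"
      using light by simp
  next
    show "range Y \<inter> range X = {}" using XY(1) by (metis disjoint_iff rangeE)
  qed (use sc' in auto)
  moreover have "follows X (\<alpha> + \<beta>) (lin u v \<alpha> \<beta>)"
    unfolding X_def i_def using pos by (intro follows_lin_stair) auto
  moreover have "follows Y (\<alpha>' + \<beta>') (lin u v \<alpha>' \<beta>')"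
    unfolding Y_def i'_def using pos by (intro follows_lin_stair) auto
  ultimately show ?thesis
    unfolding tracks_cross_def using w1 by blast
qed

text \<open>
  In the coordinates of the basis \<open>u\<close>, \<open>v\<close>, the track \<open>X\<close> contains the vertical run from \<open>(0, 0)\<close> to
  \<open>(0, M)\<close>, and \<open>Y\<close> jumps by \<open>p\<close> from \<open>(1, h)\<close> to \<open>(1 - a, h + b)\<close> between two vertical runs of length \<open>K\<close>.
  The function \<open>f\<close> measures the position relative to lines in the direction of \<open>X\<close>; outside its
  vertical runs, \<open>Y\<close> is far below or far above \<open>X\<close> with respect to \<open>f\<close>. Hence neither
  track ever receives \<open>v\<close>-grains from the other one, and the target of the jump receives no \<open>u\<close>-grains, so
  that weights with \<open>p < u < v\<close>, each exceeding the sum of all lighter ones, suffice.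
\<close>

lemma tracks_cross_jump:
  assumes fin: "finite P" and uvp: "u \<in> P" "v \<in> P" "p \<in> P" and uv1: "wedge u v = 1"
    and p: "p = lin u v (- a) b" "a \<ge> 2"
    and pos: "\<alpha> > 0" "\<beta> > 0" "\<alpha>' > 0" "\<beta>' > 0" and slope: "\<alpha>' * \<beta> < \<alpha> * \<beta>'"
  shows "\<exists>w. tracks_cross P w (\<alpha> + \<beta>) (lin u v \<alpha> \<beta>) (\<alpha>' + \<beta>') (lin u v \<alpha>' \<beta>')"
proof -
  define L where "L = \<alpha> + \<beta>"
  define L' where "L' = \<alpha>' + \<beta>'"
  \<comment> \<open>\<open>h\<close> puts both ends of the jump at height at least 2, above all of
    \<open>X\<close> left of column 0. \<open>M\<close> keeps \<open>X\<close> in column 0 until it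
    is two rows above the run of \<open>Y\<close> in column 1. \<open>K\<close> is so large that the
    outer ends of the runs of \<open>Y\<close> lie outside the range of \<open>f\<close> on
    \<open>X\<close>.\<close>
  define h where "h = 2 + \<bar>b\<bar>"
  define M where "M = h + 2"
  define K where "K = M + h + 3 * L + 2 * \<bar>b\<bar>"
  define z where "z = stair \<alpha> L"
  define z' where "z' = stair \<alpha>' L'"
  \<comment> \<open>The argument of \<open>z\<close> is a clock that stands still for
    \<open>M\<close> steps, during which every step is \<open>v\<close>. The clock of
    \<open>Y\<close> stands still for \<open>K\<close> steps before and after the jump, which takes
    place between times 0 and 1.\<close>
  define iX where "iX k = z (min k 0 + max (k - M) 0)" for k
  define iY where "iY k = (if k \<le> 0 then 1 + z' (min (k + K) 0) else 1 - a + z' (max (k - 1 - K) 0))" for k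
  define jY where "jY k = (if k \<le> 0 then h + 1 + k - iY k else h + b - a + k - iY k)" for k
  define X where "X k = 0 + lin u v (iX k) (k - iX k)" for k
  define Y where "Y k = 0 + lin u v (iY k) (jY k)" for k
  define f where "f i j = \<alpha> * j - \<beta> * i" for i j
  note defs = h_def M_def K_def
  have ne: "wedge u v \<noteq> 0" using uv1 by simp
  note lin_eq = lin_eq_iff[OF ne]
  have pL: "0 < \<alpha>" "\<alpha> < L" "0 < \<alpha>'" "\<alpha>' < L'" "0 < L" "0 < L'" using pos by (auto simp: L_def L'_def)
  have M0: "M > 0" "h \<ge> 2" "h + b \<ge> 2" "K > 0" using pL by (auto simp: defs)
  have zstep: "z (k + 1) = z k \<or> z (k + 1) = z k + 1" "z' (k + 1) = z' k \<or> z' (k + 1) = z' k + 1" for k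
    unfolding z_def z'_def using stair_step pL by blast+
  have z0: "z 0 = 0" "z' 0 = 0" by (simp_all add: z_def z'_def)

  have fX: "0 \<le> f (iX k) (k - iX k)" "f (iX k) (k - iX k) < \<alpha> * M + L" for k
  proof -
    define \<phi> where "\<phi> = min k 0 + max (k - M) 0"
    have "f (iX k) (k - iX k) = \<alpha> * (k - \<phi>) + (\<alpha> * \<phi> - L * z \<phi>)"
      by (simp add: f_def iX_def \<phi>_def L_def algebra_simps)
    moreover have "0 \<le> k - \<phi>" "k - \<phi> \<le> M" using M0 by (auto simp: \<phi>_def)
    then have "0 \<le> \<alpha> * (k - \<phi>)" "\<alpha> * (k - \<phi>) \<le> \<alpha> * M" using pL by simp_all
    ultimately show "0 \<le> f (iX k) (k - iX k)" "f (iX k) (k - iX k) < \<alpha> * M + L"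
      using stair_bounds[OF pL(5), of \<alpha> \<phi>] by (auto simp: z_def)
  qed
  have X_left: "k - iX k \<le> 0" if "iX k < 0" for k
  proof -
    have "k < 0"
    proof (rule ccontr)
      assume "\<not> k < 0"
      then have "0 \<le> iX k" unfolding iX_def z_def using pL M0 by (intro stair_nonneg) auto
      then show False using that by simp
    qed
    then show ?thesis using stair_nonpos(2)[OF pL(1,2), of k] M0 by (simp add: iX_def z_def)
  qed
  have X_right: "k - iX k \<ge> M" if "iX k > 0" for k
  proof -
    have "k > M"
    proof (rule ccontr)
      assume "\<not> k > M"
      then have "iX k \<le> 0" unfolding iX_def z_def using pL M0 by (intro stair_nonpos) auto
      then show False using that by simp
    qed
    then show ?thesis using stair_nonneg(2)[OF pL(1,2), of "k - M"] M0 by (simp add: iX_def z_def)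
  qed

  \<comment> \<open>\<open>\<alpha> * k - L * z' k\<close> is the value of \<open>f\<close> on the
    staircase underlying \<open>Y\<close>. By \<open>slope\<close> that staircase is steeper than
    the direction of \<open>X\<close>, so this value grows linearly in \<open>k\<close> up to a
    bounded error.\<close>
  have drift: "L' * (\<alpha> * k - L * z' k) = k * (\<alpha> * \<beta>' - \<alpha>' * \<beta>) + L * (\<alpha>' * k - L' * z' k)" for k
    by (simp add: L_def L'_def algebra_simps)
  have drift_neg: "\<alpha> * k - L * z' k \<le> L" if "k \<le> 0" for k
  proof -
    have "k * (\<alpha> * \<beta>' - \<alpha>' * \<beta>) \<le> 0" using that slope by (simp add: mult_nonpos_nonneg)
    moreover have "L * (\<alpha>' * k - L' * z' k) \<le> L * L'"
      using stair_bounds(2)[OF pL(6), of \<alpha>' k] pL by (intro mult_left_mono) (auto simp: z'_def)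
    ultimately have "L' * (\<alpha> * k - L * z' k) \<le> L' * L" using drift[of k] by (simp add: mult.commute)
    then show ?thesis using pL by simp
  qed
  have drift_pos: "0 \<le> \<alpha> * k - L * z' k" if "k \<ge> 0" for k
  proof -
    have "k * (\<alpha> * \<beta>' - \<alpha>' * \<beta>) \<ge> 0" using that slope by simp
    moreover have "L * (\<alpha>' * k - L' * z' k) \<ge> 0"
      using stair_bounds(1)[OF pL(6), of \<alpha>' k] pL by (auto simp: z'_def)
    ultimately have "L' * (\<alpha> * k - L * z' k) \<ge> 0" using drift[of k] by simp
    then show ?thesis using pL by (simp add: zero_le_mult_iff)
  qed
  have Y_before: "jY k \<le> h \<and> (iY k = 1 \<or> f (iY k) (jY k) \<le> - 2 * L \<and> jY k \<le> h - K)" if "k \<le> 0" for k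
  proof (cases "k + K \<le> 0")
    case False
    then show ?thesis using that z0 by (auto simp: iY_def jY_def)
  next
    case True
    define l where "l = k + K"
    have eq: "iY k = 1 + z' l" "jY k = h - K + (l - z' l)" using that True by (auto simp: iY_def jY_def l_def)
    have "l - z' l \<le> 0" using stair_nonpos(2)[OF pL(3,4), of l] True by (simp add: z'_def l_def)
    moreover have "f (iY k) (jY k) = \<alpha> * (h - K) - \<beta> + (\<alpha> * l - L * z' l)"
      by (simp add: eq f_def L_def algebra_simps)
    moreover have "\<alpha> * (h - K) \<le> 1 * (h - K)"
      using pL M0 by (intro mult_right_mono_neg) (auto simp: defs)
    moreover have "h - K \<le> - 3 * L" using pL by (auto simp: defs)
    ultimately show ?thesis using eq drift_neg[of l] True pos M0 by (auto simp: l_def)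
  qed
  have Y_after: "jY k \<ge> h + b \<and> (iY k = 1 - a \<or> f (iY k) (jY k) \<ge> \<alpha> * M + 3 * L \<and> jY k \<ge> h + b + K)"
    if "k \<ge> 1" for k
  proof (cases "k - 1 - K \<ge> 0")
    case False
    then show ?thesis using that z0 by (auto simp: iY_def jY_def)
  next
    case True
    define l where "l = k - 1 - K"
    have eq: "iY k = 1 - a + z' l" "jY k = h + b + K + (l - z' l)" using that True by (auto simp: iY_def jY_def l_def)
    have "l - z' l \<ge> 0" using stair_nonneg(2)[OF pL(3,4), of l] True by (simp add: z'_def l_def)
    moreover have "f (iY k) (jY k) = \<alpha> * M + \<alpha> * (h + b + K - M) + \<beta> * (a - 1) + (\<alpha> * l - L * z' l)"
      by (simp add: eq f_def L_def algebra_simps)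
    moreover have "1 * (h + b + K - M) \<le> \<alpha> * (h + b + K - M)"
      using pL M0 by (intro mult_right_mono) (auto simp: defs)
    moreover have "h + b + K - M \<ge> 3 * L" using pL by (auto simp: defs)
    moreover have "\<beta> * (a - 1) \<ge> 0" using pos p(2) by simp
    ultimately show ?thesis using eq drift_pos[of l] True M0 by (auto simp: l_def)
  qed
  have apart: "\<not> (iX k = iY l \<and> k - iX k = jY l)"
    "\<not> (iX k = iY l \<and> k - iX k - 1 = jY l)"
    "\<not> (iX k = iY l \<and> k - iX k = jY l - 1)" for k l
  proof -
    have F: "f i (j - 1) = f i j - \<alpha>" for i j by (simp add: f_def algebra_simps)
    \<comment> \<open>On its vertical runs \<open>Y\<close> is kept from \<open>X\<close> by column
      and height, elsewhere by the value of \<open>f\<close>.\<close>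
    consider "l \<le> 0" "iY l = 1" "jY l \<le> h" | "f (iY l) (jY l) \<le> - 2 * L"
      | "iY l = 1 - a" "jY l \<ge> 2" | "f (iY l) (jY l) \<ge> \<alpha> * M + 3 * L"
      using Y_before[of l] Y_after[of l] M0 by fastforce
    then have "\<not> (iX k = iY l \<and> k - iX k = jY l) \<and> \<not> (iX k = iY l \<and> k - iX k - 1 = jY l) \<and>
      \<not> (iX k = iY l \<and> k - iX k = jY l - 1)"
    proof cases
      case 1
      then show ?thesis using X_right[of k] by (auto simp: M_def)
    next
      case 2
      then show ?thesis using fX[of k] F[of "iY l" "jY l"] F[of "iX k" "k - iX k"] pL by force
    next
      case 3
      then show ?thesis using X_left[of k] p(2) by auto
    next
      case 4
      then show ?thesis using fX[of k] F[of "iY l" "jY l"] F[of "iX k" "k - iX k"] pL by force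
    qed
    then show "\<not> (iX k = iY l \<and> k - iX k = jY l)"
      "\<not> (iX k = iY l \<and> k - iX k - 1 = jY l)"
      "\<not> (iX k = iY l \<and> k - iX k = jY l - 1)" by auto
  qed
  have unit: "lin u v i j - u = lin u v (i - 1) j" "lin u v i j - v = lin u v i (j - 1)" for i j
    by (simp_all add: lin_def prod_eq_iff algebra_simps)
  have XY: "X k \<noteq> Y l" "X k - v \<noteq> Y l" "Y l - v \<noteq> X k" for k l
    using apart[of k l] by (auto simp: X_def Y_def unit lin_eq)

  have iXstep: "iX (k + 1) = iX k \<or> iX (k + 1) = iX k + 1" for k
  proof -
    have "min (k + 1) 0 + max (k + 1 - M) 0 = min k 0 + max (k - M) 0 \<or>
      min (k + 1) 0 + max (k + 1 - M) 0 = min k 0 + max (k - M) 0 + 1"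
      using M0 by auto
    then show ?thesis unfolding iX_def using zstep(1) by metis
  qed
  note sc = stair_track[where i = iX and t = 0, OF uvp(1,2) ne iXstep, folded X_def]
  have Ystep: "Y (k + 1) - Y k \<in> {u, v}" if "k \<noteq> 0" for k
  proof -
    have z'le: "z' y = z' x \<or> z' y = z' x + 1" if "y = x \<or> y = x + 1" for x y
      using zstep(2)[of x] that by auto
    have "z' (min (k + 1 + K) 0) = z' (min (k + K) 0) \<or> z' (min (k + 1 + K) 0) = z' (min (k + K) 0) + 1"
      "z' (max (k + 1 - 1 - K) 0) = z' (max (k - 1 - K) 0) \<or> z' (max (k + 1 - 1 - K) 0) = z' (max (k - 1 - K) 0) + 1"
      by (rule z'le; arith)+
    then have "iY (k + 1) = iY k \<or> iY (k + 1) = iY k + 1"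
      using that unfolding iY_def by (cases "k \<le> -1") auto
    moreover have "iY (k + 1) + jY (k + 1) = iY k + jY k + 1" using that by (auto simp: jY_def)
    ultimately have "(iY (k + 1) - iY k = 0 \<and> jY (k + 1) - jY k = 1) \<or> (iY (k + 1) - iY k = 1 \<and> jY (k + 1) - jY k = 0)"
      by auto
    then show ?thesis by (auto simp: Y_def lin_diff)
  qed
  have Y01: "iY 0 = 1" "jY 0 = h" "iY 1 = 1 - a" "jY 1 = h + b"
    using M0 z0 by (auto simp: iY_def jY_def)
  have Yjump: "Y (0 + 1) - Y 0 = p"
    by (simp add: Y_def lin_diff Y01 p)
  \<comment> \<open>The source of a \<open>u\<close>-grain is in column \<open>- a\<close>, left of
    column 0, where \<open>X\<close> has height at most 0, whereas this source has height
    \<open>h + b\<close>. For \<open>a = 1\<close> the landing cell itself would be in column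
    0.\<close>
  have landing: "Y 1 - u \<noteq> X k" for k
    using X_left[of k] M0 p(2) by (auto simp: Y_def X_def unit Y01 lin_eq)
  \<comment> \<open>\<open>K\<close> is so long that this closeness in height occurs only on the two
    vertical runs, in columns \<open>1 - a\<close> and 1. It rules out coincidences between the
    halves of \<open>Y\<close>, both for injectivity and for the condition on empty cells.\<close>
  have sep: "iY k \<le> iY l - 2" if "k \<ge> 1" "l \<le> 0" "jY k \<le> jY l + 1" for k l
    using Y_before[OF that(2)] Y_after[OF that(1)] that(3) p(2) pL by (auto simp: defs)
  have same: "k = l" if "iY k + jY k = iY l + jY l" "k \<ge> 1 \<longleftrightarrow> l \<ge> 1" for k l
    using that by (auto simp: jY_def split: if_splits)
  have injY: "inj Y"
  proof (rule injI)
    fix k l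
    assume "Y k = Y l"
    then have eq: "iY k = iY l" "jY k = jY l" by (auto simp: Y_def lin_eq)
    then have "k \<ge> 1 \<longleftrightarrow> l \<ge> 1" using sep[of k l] sep[of l k]
      by (cases "k \<le> 0"; cases "l \<le> 0") auto
    then show "k = l" using same[of k l] eq by simp
  qed
  have defect: "\<exists>r\<in>P. y - r \<notin> range Y" for y
  proof (rule ccontr)
    assume "\<not> ?thesis"
    then obtain k l where kl: "y - u = Y k" "y - v = Y l" using uvp by blast
    have "Y k + u = Y l + v" unfolding kl[symmetric] by simp
    then have "lin u v (iY k) (jY k) + lin u v 1 0 = lin u v (iY l) (jY l) + lin u v 0 1"
      by (simp add: Y_def)
    then have eq: "iY k + 1 = iY l" "jY k = jY l + 1" unfolding lin_add by (simp_all add: lin_eq)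
    then have "k \<ge> 1 \<longleftrightarrow> l \<ge> 1" using sep[of k l] sep[of l k]
      by (cases "k \<le> 0"; cases "l \<le> 0") auto
    then have "k = l" using same[of k l] eq by simp
    then show False using eq by simp
  qed

  define m where "m = card P"
  define w where "w r = (if r = v then 4 * m else if r = u then 2 * m else if r = p then m else 1)" for r
  have distinct: "u \<noteq> v" "u \<noteq> p" "v \<noteq> p"
    using uv1 p(2) wedge_lin_left[of u v "- a" b v] unfolding p(1) by auto
  have m0: "m > 0" using fin uvp by (auto simp: m_def card_gt_0_iff)
  have w1: "\<forall>r\<in>P. w r \<ge> 1" using m0 by (auto simp: w_def)
  have s3: "sum w (P - {u, v, p}) < m"
  proof -
    have "sum w (P - {u, v, p}) = card (P - {u, v, p})"
      by (subst card_eq_sum, intro sum.cong) (auto simp: w_def)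
    also have "\<dots> < m" unfolding m_def using fin uvp by (intro psubset_card_mono) auto
    finally show ?thesis .
  qed
  have "P - {u, v} = insert p (P - {u, v, p})" "P - {v} = insert u (P - {u, v})"
    using uvp distinct by auto
  then have "sum w (P - {u, v}) = w p + sum w (P - {u, v, p})"
    "sum w (P - {v}) = w u + sum w (P - {u, v})"
    using fin by (metis (no_types, lifting) Diff_iff finite_Diff insertCI sum.insert)+
  then have s2: "sum w (P - {u, v}) < w u" "sum w (P - {v}) < w v"
    using s3 distinct by (auto simp: w_def)
  have sub: "sum w S < x" if "S \<subseteq> T" "T \<subseteq> P" "sum w T < x" for S T x
    using sum_mono2[of T S w] that fin finite_subset by fastforce
  have "track P w X (range Y)"
    unfolding track_def
  proof (intro conjI allI)
    fix k
    have own: "X (k + 1) - r \<notin> range Y" if "X (k + 1) - X k = r" for r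
    proof
      assume "X (k + 1) - r \<in> range Y"
      then obtain l where "X (k + 1) - r = Y l" by blast
      then have "X k = Y l" using that by (auto simp: algebra_simps)
      then show False using XY(1) by blast
    qed
    have nv: "X (k + 1) - v \<notin> range Y" using XY(2) by (metis rangeE)
    have "X (k + 1) - X k = u \<or> X (k + 1) - X k = v" using sc(2)[of k] by simp
    then have "X (k + 1) - X k \<in> P \<and>
      (\<Sum>r | r \<in> P \<and> X (k + 1) - r \<in> range Y. w r) < w (X (k + 1) - X k)"
    proof
      assume e: "X (k + 1) - X k = u"
      then have "{r. r \<in> P \<and> X (k + 1) - r \<in> range Y} \<subseteq> P - {u, v}"
        using own[OF e] nv by blast
      from sub[OF this Diff_subset s2(1)] show ?thesis using e uvp by simp
    next
      assume e: "X (k + 1) - X k = v"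
      then have "{r. r \<in> P \<and> X (k + 1) - r \<in> range Y} \<subseteq> P - {v}"
        using own[OF e] by blast
      from sub[OF this Diff_subset s2(2)] show ?thesis using e uvp by simp
    qed
    then show "X (k + 1) - X k \<in> P"
      "(\<Sum>r | r \<in> P \<and> X (k + 1) - r \<in> range Y. w r) < w (X (k + 1) - X k)" by simp_all
  next
    show "range X \<inter> range Y = {}" using XY(1) by (metis disjoint_iff rangeE)
  qed (use sc in auto)
  moreover have "track P w Y (range X)"
    unfolding track_def
  proof (intro conjI allI)
    fix k
    have own: "Y (k + 1) - r \<notin> range X" if "Y (k + 1) - Y k = r" for r
    proof
      assume "Y (k + 1) - r \<in> range X"
      then obtain l where "Y (k + 1) - r = X l" by blast
      then have "X l = Y k" using that by (auto simp: algebra_simps)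
      then show False using XY(1) by blast
    qed
    have nv: "Y (k + 1) - v \<notin> range X" using XY(3) by (metis rangeE)
    consider "Y (k + 1) - Y k = u" | "Y (k + 1) - Y k = v" | "k = 0" using Ystep[of k] by auto
    then have "Y (k + 1) - Y k \<in> P \<and>
      (\<Sum>r | r \<in> P \<and> Y (k + 1) - r \<in> range X. w r) < w (Y (k + 1) - Y k)"
    proof cases
      case 1
      have "{r. r \<in> P \<and> Y (k + 1) - r \<in> range X} \<subseteq> P - {u, v}"
        using own[OF 1] nv by blast
      from sub[OF this Diff_subset s2(1)] show ?thesis using 1 uvp by simp
    next
      case 2
      have "{r. r \<in> P \<and> Y (k + 1) - r \<in> range X} \<subseteq> P - {v}"
        using own[OF 2] by blast
      from sub[OF this Diff_subset s2(2)] show ?thesis using 2 uvp by simp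
    next
      case 3
      have "Y (k + 1) - p \<notin> range X" using own[of p] Yjump 3 by simp
      moreover have "Y (k + 1) - u \<notin> range X" using landing 3 by auto
      ultimately have "{r. r \<in> P \<and> Y (k + 1) - r \<in> range X} \<subseteq> P - {u, v, p}"
        using nv by blast
      from sub[OF this Diff_subset s3] show ?thesis using Yjump 3 uvp distinct by (simp add: w_def)
    qed
    then show "Y (k + 1) - Y k \<in> P"
      "(\<Sum>r | r \<in> P \<and> Y (k + 1) - r \<in> range X. w r) < w (Y (k + 1) - Y k)" by simp_all
  next
    show "range Y \<inter> range X = {}" using XY(1) by (metis disjoint_iff rangeE)
  qed (use injY defect in auto)
  moreover have "follows X (\<alpha> + \<beta>) (lin u v \<alpha> \<beta>)"
    unfolding X_def
  proof (rule follows_lin)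
    fix k
    define \<phi> where "\<phi> = min k 0 + max (k - M) 0"
    have "L * iX k - \<alpha> * k = (L * z \<phi> - \<alpha> * \<phi>) - \<alpha> * (k - \<phi>)"
      by (simp add: iX_def \<phi>_def algebra_simps)
    moreover have "0 \<le> k - \<phi>" "k - \<phi> \<le> M" using M0 by (auto simp: \<phi>_def)
    then have "0 \<le> \<alpha> * (k - \<phi>)" "\<alpha> * (k - \<phi>) \<le> \<alpha> * M" using pL by simp_all
    ultimately show 1: "\<bar>(\<alpha> + \<beta>) * iX k - \<alpha> * k\<bar> \<le> L + \<alpha> * M"
      using stair_bounds[OF pL(5), of \<alpha> \<phi>] by (auto simp: z_def L_def)
    have "(\<alpha> + \<beta>) * (k - iX k) - \<beta> * k = - ((\<alpha> + \<beta>) * iX k - \<alpha> * k)"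
      by (simp add: algebra_simps)
    then show "\<bar>(\<alpha> + \<beta>) * (k - iX k) - \<beta> * k\<bar> \<le> L + \<alpha> * M" using 1 by linarith
  qed
  moreover have "follows Y (\<alpha>' + \<beta>') (lin u v \<alpha>' \<beta>')"
    unfolding Y_def
  proof (rule follows_lin)
    fix k
    define \<phi> where "\<phi> = (if k \<le> 0 then min (k + K) 0 else max (k - 1 - K) 0)"
    define c where "c = (if k \<le> 0 then 1 else 1 - a)"
    define s where "s = (if k \<le> 0 then h + 1 else h + b - a)"
    define C where "C = L' * (K + 2 + a) + L' * (h + 1 + \<bar>b\<bar> + a)"
    have "L' * iY k - \<alpha>' * k = L' * c - \<alpha>' * (k - \<phi>) + (L' * z' \<phi> - \<alpha>' * \<phi>)"
      by (simp add: iY_def \<phi>_def c_def algebra_simps)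
    moreover have "\<bar>L' * c\<bar> \<le> L' * a"
      using pL p(2) by (auto simp: abs_mult c_def)
    moreover have "\<bar>k - \<phi>\<bar> \<le> K + 1" using M0 by (auto simp: \<phi>_def)
    then have "\<bar>\<alpha>' * (k - \<phi>)\<bar> \<le> L' * (K + 1)"
      using pL unfolding abs_mult by (intro mult_mono) auto
    moreover have "\<bar>L' * z' \<phi> - \<alpha>' * \<phi>\<bar> \<le> L'"
      using stair_bounds[OF pL(6), of \<alpha>' \<phi>] by (auto simp: z'_def)
    ultimately have "\<bar>L' * iY k - \<alpha>' * k\<bar> \<le> L' * a + L' * (K + 1) + L'" by linarith
    also have "\<dots> = L' * (K + 2 + a)" by (simp add: algebra_simps)
    finally have 1: "\<bar>L' * iY k - \<alpha>' * k\<bar> \<le> L' * (K + 2 + a)" .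
    have "0 \<le> L' * (h + 1 + \<bar>b\<bar> + a)"
      using pL p(2) M0 by (intro mult_nonneg_nonneg) auto
    then have "L' * (K + 2 + a) \<le> C" by (simp add: C_def)
    then show "\<bar>(\<alpha>' + \<beta>') * iY k - \<alpha>' * k\<bar> \<le> C" using 1 by (simp add: L'_def)
    have "(\<alpha>' + \<beta>') * jY k - \<beta>' * k = L' * s - (L' * iY k - \<alpha>' * k)"
      by (simp add: jY_def s_def L'_def algebra_simps)
    moreover have "\<bar>s\<bar> \<le> h + 1 + \<bar>b\<bar> + a" using p(2) M0 by (auto simp: s_def)
    then have "\<bar>L' * s\<bar> \<le> L' * (h + 1 + \<bar>b\<bar> + a)"
      using pL unfolding abs_mult by (intro mult_mono) auto
    ultimately show "\<bar>(\<alpha>' + \<beta>') * jY k - \<beta>' * k\<bar> \<le> C"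
      using 1 unfolding C_def by linarith
  qed
  ultimately show ?thesis
    unfolding tracks_cross_def using w1 by blast
qed

section \<open>Truncation to a finite grid\<close>

text \<open>Beyond the conditions of a track, the start must receive nothing from \<open>B\<close>:
  it will lack only the added grain, so any single grain would trigger it.\<close>

definition route :: "cell set \<Rightarrow> (cell \<Rightarrow> nat) \<Rightarrow> nat \<Rightarrow> (nat \<Rightarrow> cell) \<Rightarrow> cell set \<Rightarrow> bool" where
  "route P w m X B \<longleftrightarrow> inj_on X {..m} \<and> X ` {..m} \<inter> B = {} \<and>
     (\<forall>k<m. X (Suc k) - X k \<in> P \<and>
        (\<Sum>r | r \<in> P \<and> X (Suc k) - r \<in> B. w r) < w (X (Suc k) - X k)) \<and>
     (\<forall>z. \<exists>r\<in>P. z - r \<notin> X ` {..m}) \<and> (\<forall>r\<in>P. X 0 - r \<notin> B)"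

text \<open>The abscissae of \<open>X\<close> and the ordinates of \<open>Y\<close> span the future
  grid: the end points lie on its four sides, and the strict inequalities keep them off the
  corners.\<close>

definition routes_cross :: "cell set \<Rightarrow> (cell \<Rightarrow> nat) \<Rightarrow> nat \<Rightarrow> (nat \<Rightarrow> cell) \<Rightarrow> nat \<Rightarrow> (nat \<Rightarrow> cell) \<Rightarrow> bool" where
  "routes_cross P w m X n Y \<longleftrightarrow>
     route P w m X (Y ` {..n}) \<and> route P w n Y (X ` {..m}) \<and>
     (\<forall>z\<in>X ` {..m}. fst (X 0) \<le> fst z \<and> fst z \<le> fst (X m) \<and> snd (Y 0) < snd z \<and> snd z < snd (Y n)) \<and>
     (\<forall>z\<in>Y ` {..n}. snd (Y 0) \<le> snd z \<and> snd z \<le> snd (Y n) \<and> fst (X 0) < fst z \<and> fst z < fst (X m))"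

lemma image_shift_nat:
  assumes "s \<le> t"
  shows "(\<lambda>k. X (s + int k)) ` {..nat (t - s)} = X ` {s..t}"
proof -
  have "(\<lambda>k. s + int k) ` {..nat (t - s)} = {s..t}"
  proof (intro equalityI subsetI)
    fix x assume "x \<in> {s..t}"
    then have "x = s + int (nat (x - s))" "nat (x - s) \<in> {..nat (t - s)}" by auto
    then show "x \<in> (\<lambda>k. s + int k) ` {..nat (t - s)}" by blast
  qed (use assms in auto)
  then show ?thesis by (metis image_image)
qed

lemma route_of_track:
  assumes "finite P" and tr: "track P w X B" and st: "s \<le> t" and B: "B' \<subseteq> B"
    and start: "\<And>r. r \<in> P \<Longrightarrow> X s - r \<notin> B'"
  shows "route P w (nat (t - s)) (\<lambda>k. X (s + int k)) B'"
  unfolding route_def image_shift_nat[OF st]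
proof (intro conjI allI impI ballI)
  show "inj_on (\<lambda>k. X (s + int k)) {..nat (t - s)}"
    using tr unfolding track_def by (auto intro!: inj_onI dest: injD)
  show "X ` {s..t} \<inter> B' = {}" using tr B unfolding track_def by blast
  fix k
  have eq: "s + int (Suc k) = (s + int k) + 1" by simp
  show "X (s + int (Suc k)) - X (s + int k) \<in> P"
    using tr unfolding track_def eq by blast
  have "(\<Sum>r | r \<in> P \<and> X (s + int (Suc k)) - r \<in> B'. w r) \<le> (\<Sum>r | r \<in> P \<and> X (s + int (Suc k)) - r \<in> B. w r)"
    using B assms(1) by (intro sum_mono2) auto
  also have "\<dots> < w (X (s + int (Suc k)) - X (s + int k))"
    using tr unfolding track_def eq by blast
  finally show "(\<Sum>r | r \<in> P \<and> X (s + int (Suc k)) - r \<in> B'. w r) < w (X (s + int (Suc k)) - X (s + int k))" .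
next
  fix z
  obtain r where "r \<in> P" "z - r \<notin> range X" using tr unfolding track_def by blast
  then show "\<exists>r\<in>P. z - r \<notin> X ` {s..t}" by blast
next
  fix r assume "r \<in> P"
  then show "X (s + int 0) - r \<notin> B'" using start by simp
qed

lemma drift_bound:
  fixes L d C n :: int
  assumes "\<bar>L * x - k * d\<bar> \<le> C" "\<bar>k\<bar> \<le> n * L" "L > 0" "d \<ge> 0"
  shows "\<bar>x\<bar> \<le> n * d + C"
proof -
  have C: "C \<ge> 0" using assms(1) by linarith
  have "\<bar>k * d\<bar> \<le> n * L * d" using assms by (auto simp: abs_mult intro!: mult_right_mono)
  moreover have "C \<le> L * C" using C assms(3) mult_right_mono[of 1 L C] by simp
  moreover have "L * (n * d + C) = n * L * d + L * C" by (simp add: algebra_simps)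
  ultimately have "\<bar>L * x\<bar> \<le> L * (n * d + C)" using assms(1) by linarith
  then show ?thesis using assms(3) by (simp add: abs_mult)
qed

text \<open>Cutting where \<open>\<phi>\<close> is extremal over the time window, instead of at the
  ends of the window, keeps everything in between on the right side of both cuts. For large
  \<open>n\<close> the drift forces the minimum to a negative and the maximum to a positive
  time.\<close>

lemma drift_extremes:
  fixes \<phi> :: "int \<Rightarrow> int"
  assumes drift: "\<And>k. \<bar>L * \<phi> k - k * d\<bar> \<le> C" and pos: "L > 0" "d > 0" and n: "n > L * C + C"
  obtains s t where "- (n * L) \<le> s" "s < t" "t \<le> n * L"
    "\<And>k. - (n * L) \<le> k \<Longrightarrow> k \<le> n * L \<Longrightarrow> \<phi> s \<le> \<phi> k \<and> \<phi> k \<le> \<phi> t"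
    "\<phi> s \<le> - (n * d) + C" "\<phi> t \<ge> n * d - C"
proof -
  have C: "C \<ge> 0" using drift[of 0] by linarith
  have n0: "n > 0" using n C pos by (smt (verit) mult_nonneg_nonneg)
  define I where "I = {- (n * L)..n * L}"
  have nL: "0 < n * L" using n0 pos by simp
  then have I: "finite I" "I \<noteq> {}" "n * L \<in> I" "- (n * L) \<in> I" by (auto simp: I_def)
  then have "Min (\<phi> ` I) \<in> \<phi> ` I" "Max (\<phi> ` I) \<in> \<phi> ` I" by auto
  then obtain s t where st: "s \<in> I" "\<phi> s = Min (\<phi> ` I)" "t \<in> I" "\<phi> t = Max (\<phi> ` I)"
    by (metis imageE)
  have ext: "\<phi> s \<le> \<phi> k" "\<phi> k \<le> \<phi> t" if "k \<in> I" for k using st I that by auto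
  have LC: "C \<le> L * C" using C pos mult_right_mono[of 1 L C] by simp
  have "L * \<phi> (- (n * L)) \<le> L * (- (n * d) + C)" using drift[of "- (n * L)"] LC by (simp add: algebra_simps)
  then have lo: "\<phi> s \<le> - (n * d) + C" using ext(1)[OF I(4)] pos by simp
  have "L * (n * d - C) \<le> L * \<phi> (n * L)" using drift[of "n * L"] LC by (simp add: algebra_simps)
  then have hi: "\<phi> t \<ge> n * d - C" using ext(2)[OF I(3)] pos by simp
  have "1 * n \<le> (L * d) * n"
    using pos n0 by (intro mult_right_mono) (auto simp: int_one_le_iff_zero_less)
  then have Lnd: "n \<le> L * (n * d)" by (simp add: algebra_simps)
  have "L * \<phi> s \<le> L * (- (n * d) + C)" using lo pos by (intro mult_left_mono) auto
  then have "s * d < 0" using drift[of s] Lnd n by (simp add: algebra_simps)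
  then have "s < 0" using pos by (simp add: mult_less_0_iff)
  have "L * (n * d - C) \<le> L * \<phi> t" using hi pos by (intro mult_left_mono) auto
  then have "t * d > 0" using drift[of t] Lnd n by (simp add: algebra_simps)
  then have "t > 0" using pos by (simp add: zero_less_mult_iff)
  show thesis
    using that[of s t] st(1,3) ext lo hi \<open>s < 0\<close> \<open>t > 0\<close> by (auto simp: I_def)
qed

text \<open>Over the same number \<open>n\<close> of periods on each side, \<open>X\<close> gets
  wider than \<open>Y\<close> and \<open>Y\<close> taller than \<open>X\<close>, by an amount that
  grows with \<open>n\<close> and finally absorbs the bounded deviations.\<close>

lemma routes_cross_of_tracks:
  assumes fin: "finite P" and cross: "tracks_cross P w L D L' D'" and L: "L > 0" "L' > 0"
    and D: "0 < fst D'" "fst D' < fst D" "0 < snd D" "snd D < snd D'"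
  shows "\<exists>m X n Y. routes_cross P w m X n Y"
proof -
  obtain X Y C1 C2 where tr: "track P w X (range Y)" "track P w Y (range X)"
    and C1: "\<And>k. \<bar>L * fst (X k) - k * fst D\<bar> \<le> C1 \<and> \<bar>L * snd (X k) - k * snd D\<bar> \<le> C1"
    and C2: "\<And>k. \<bar>L' * fst (Y k) - k * fst D'\<bar> \<le> C2 \<and> \<bar>L' * snd (Y k) - k * snd D'\<bar> \<le> C2"
    using cross unfolding tracks_cross_def follows_def by metis
  define C where "C = max C1 C2"
  define R where "R = (\<Sum>r\<in>P. \<bar>fst r\<bar> + \<bar>snd r\<bar>)"
  \<comment> \<open>Large enough for \<open>drift_extremes\<close> on both tracks, and for the gap
    to exceed two deviations \<open>C\<close> plus one step, whose length is at most
    \<open>R\<close>.\<close>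
  define n where "n = 1 + 2 * C + R + (L * C + C) + (L' * C + C)"
  have dX: "\<bar>L * fst (X k) - k * fst D\<bar> \<le> C" "\<bar>L * snd (X k) - k * snd D\<bar> \<le> C"
    and dY: "\<bar>L' * fst (Y k) - k * fst D'\<bar> \<le> C" "\<bar>L' * snd (Y k) - k * snd D'\<bar> \<le> C" for k
    using C1[of k] C2[of k] by (auto simp: C_def)
  have C0: "C \<ge> 0" using dX(1)[of 0] by linarith
  have R: "\<bar>fst r\<bar> + \<bar>snd r\<bar> \<le> R" if "r \<in> P" for r
    unfolding R_def by (rule member_le_sum[OF that _ fin]) simp
  have R0: "R \<ge> 0" by (auto simp: R_def intro!: sum_nonneg)
  have nC: "n > L * C + C" "n > L' * C + C" "n > 2 * C + R"
    using C0 R0 L by (simp_all add: n_def add_nonneg_pos add_pos_nonneg)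
  obtain s t where st: "- (n * L) \<le> s" "s < t" "t \<le> n * L"
    "\<And>k. - (n * L) \<le> k \<Longrightarrow> k \<le> n * L \<Longrightarrow> fst (X s) \<le> fst (X k) \<and> fst (X k) \<le> fst (X t)"
    "fst (X s) \<le> - (n * fst D) + C" "fst (X t) \<ge> n * fst D - C"
    using drift_extremes[where \<phi> = "\<lambda>k. fst (X k)", OF dX(1) L(1) _ nC(1)] D by auto
  obtain s' t' where st': "- (n * L') \<le> s'" "s' < t'" "t' \<le> n * L'"
    "\<And>k. - (n * L') \<le> k \<Longrightarrow> k \<le> n * L' \<Longrightarrow> snd (Y s') \<le> snd (Y k) \<and> snd (Y k) \<le> snd (Y t')"
    "snd (Y s') \<le> - (n * snd D') + C" "snd (Y t') \<ge> n * snd D' - C"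
    using drift_extremes[where \<phi> = "\<lambda>k. snd (Y k)", OF dY(2) L(2) _ nC(2)] D by auto
  have "n * 1 \<le> n * (fst D - fst D')" "n * 1 \<le> n * (snd D' - snd D)"
    using D nC(3) C0 R0 by (intro mult_left_mono; auto)+
  then have gap: "n * fst D' + n \<le> n * fst D" "n * snd D + n \<le> n * snd D'"
    by (simp_all add: algebra_simps)
  have bX: "\<bar>snd z\<bar> \<le> n * snd D + C" if "z \<in> X ` {s..t}" for z
    using that st drift_bound[OF dX(2)] L D by (auto simp: abs_le_iff)
  have bY: "\<bar>fst z\<bar> \<le> n * fst D' + C" if "z \<in> Y ` {s'..t'}" for z
    using that st' drift_bound[OF dY(1)] L D by (auto simp: abs_le_iff)
  let ?X = "\<lambda>k. X (s + int k)" and ?Y = "\<lambda>k. Y (s' + int k)"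
  let ?m = "nat (t - s)" and ?n = "nat (t' - s')"
  have im: "?X ` {..?m} = X ` {s..t}" "?Y ` {..?n} = Y ` {s'..t'}"
    using st(2) st'(2) by (simp_all add: image_shift_nat)
  have ends: "?X 0 = X s" "?X ?m = X t" "?Y 0 = Y s'" "?Y ?n = Y t'"
    using st(2) st'(2) by simp_all
  have "route P w ?m ?X (Y ` {s'..t'})"
  proof (rule route_of_track[OF fin tr(1)])
    fix r assume r: "r \<in> P"
    show "X s - r \<notin> Y ` {s'..t'}"
    proof
      assume "X s - r \<in> Y ` {s'..t'}"
      from bY[OF this] R[OF r] st(5) gap nC(3) show False by (auto simp: abs_if split: if_splits)
    qed
  qed (use st in auto)
  moreover have "route P w ?n ?Y (X ` {s..t})"
  proof (rule route_of_track[OF fin tr(2)])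
    fix r assume r: "r \<in> P"
    show "Y s' - r \<notin> X ` {s..t}"
    proof
      assume "Y s' - r \<in> X ` {s..t}"
      from bX[OF this] R[OF r] st'(5) gap nC(3) show False by (auto simp: abs_if split: if_splits)
    qed
  qed (use st' in auto)
  moreover have "\<forall>z\<in>X ` {s..t}. fst (X s) \<le> fst z \<and> fst z \<le> fst (X t) \<and> snd (Y s') < snd z \<and> snd z < snd (Y t')"
  proof
    fix z assume z: "z \<in> X ` {s..t}"
    have "fst (X s) \<le> fst z \<and> fst z \<le> fst (X t)" using z st(1-4) by auto
    moreover have "snd (Y s') < snd z \<and> snd z < snd (Y t')"
      using bX[OF z] st'(5,6) gap nC(3) R0 by (auto simp: abs_if split: if_splits)
    ultimately show "fst (X s) \<le> fst z \<and> fst z \<le> fst (X t) \<and> snd (Y s') < snd z \<and> snd z < snd (Y t')"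
      by blast
  qed
  moreover have "\<forall>z\<in>Y ` {s'..t'}. snd (Y s') \<le> snd z \<and> snd z \<le> snd (Y t') \<and> fst (X s) < fst z \<and> fst z < fst (X t)"
  proof
    fix z assume z: "z \<in> Y ` {s'..t'}"
    have "snd (Y s') \<le> snd z \<and> snd z \<le> snd (Y t')" using z st'(1-4) by auto
    moreover have "fst (X s) < fst z \<and> fst z < fst (X t)"
      using bY[OF z] st(5,6) gap nC(3) R0 by (auto simp: abs_if split: if_splits)
    ultimately show "snd (Y s') \<le> snd z \<and> snd z \<le> snd (Y t') \<and> fst (X s) < fst z \<and> fst z < fst (X t)"
      by blast
  qed
  ultimately have "routes_cross P w ?m ?X ?n ?Y"
    unfolding routes_cross_def im ends by blast
  then show ?thesis by blast
qed

section \<open>Uniform grids\<close>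

definition toppled :: "nat \<Rightarrow> nat \<Rightarrow> (cell \<Rightarrow> neighborhood) \<Rightarrow> (cell \<Rightarrow> nat) \<Rightarrow> nat \<Rightarrow> cell set" where
  "toppled l l' N c t = {u \<in> cells l l'. \<exists>s<t. \<not> stable_cell N ((step l l' N ^^ s) c) u}"

lemma finite_cells [simp]: "finite (cells l l')"
  by (simp add: cells_def)

lemma toppled_subset: "toppled l l' N c t \<subseteq> cells l l'"
  by (auto simp: toppled_def)

lemma finite_toppled [simp]: "finite (toppled l l' N c t)"
  by (rule finite_subset[OF toppled_subset]) simp

lemma toppled_mono: "s \<le> t \<Longrightarrow> toppled l l' N c s \<subseteq> toppled l l' N c t"
  unfolding toppled_def using less_le_trans by blast

lemma toppled_0 [simp]: "toppled l l' N c 0 = {}"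
  by (simp add: toppled_def)

lemma toppled_Suc:
  "toppled l l' N c (Suc t) =
     toppled l l' N c t \<union> {u \<in> cells l l'. \<not> stable_cell N ((step l l' N ^^ t) c) u}"
  by (auto simp: toppled_def less_Suc_eq)

lemma topples_iff: "topples l l' N c u \<longleftrightarrow> (\<exists>t. u \<in> toppled l l' N c t)"
  by (auto simp: topples_def toppled_def)

lemma step_uniform:
  assumes "u \<in> cells l l'"
  shows "step l l' (\<lambda>_. M) c u = c u - (if c u \<ge> size M then size M else 0) +
    (\<Sum>v | v \<in> cells l l' \<and> \<not> stable_cell (\<lambda>_. M) c v. count M (u - v))"
proof -
  have "(\<Sum>v\<in>cells l l'. count M (u - v) * H (int (c v) - int (size M))) =
    (\<Sum>v\<in>cells l l'. if \<not> stable_cell (\<lambda>_. M) c v then count M (u - v) else 0)"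
    by (intro sum.cong) (auto simp: H_def stable_cell_def)
  also have "\<dots> = (\<Sum>v | v \<in> cells l l' \<and> \<not> stable_cell (\<lambda>_. M) c v. count M (u - v))"
    by (simp add: sum.inter_filter[symmetric])
  finally show ?thesis using assms by (simp add: step_def H_def)
qed

text \<open>
  Under this bound no cell topples twice: after its first toppling a cell can never again
  collect \<open>size M\<close> grains.
\<close>

lemma uniform_grains:
  assumes bound: "\<And>u. u \<in> cells l l' \<Longrightarrow> c u + (\<Sum>v\<in>cells l l'. count M (u - v)) < 2 * size M"
    and u: "u \<in> cells l l'"
  shows "(step l l' (\<lambda>_. M) ^^ t) c u + (if u \<in> toppled l l' (\<lambda>_. M) c t then size M else 0) =
    c u + (\<Sum>v\<in>toppled l l' (\<lambda>_. M) c t. count M (u - v))"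
  using u
proof (induction t arbitrary: u)
  case 0
  then show ?case by simp
next
  case (Suc t)
  let ?c = "(step l l' (\<lambda>_. M) ^^ t) c"
  let ?T = "toppled l l' (\<lambda>_. M) c t"
  let ?U = "{v \<in> cells l l'. \<not> stable_cell (\<lambda>_. M) ?c v}"
  have once: "?c v < size M" if "v \<in> ?T" for v
  proof -
    have v: "v \<in> cells l l'" using that toppled_subset by blast
    have "(\<Sum>x\<in>?T. count M (v - x)) \<le> (\<Sum>x\<in>cells l l'. count M (v - x))"
      by (intro sum_mono2) (use toppled_subset in auto)
    then show ?thesis using Suc.IH[OF v] bound[OF v] that by simp
  qed
  then have disj: "?T \<inter> ?U = {}" by (auto simp: stable_cell_def)
  have "(\<Sum>v\<in>toppled l l' (\<lambda>_. M) c (Suc t). count M (u - v)) =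
    (\<Sum>v\<in>?T. count M (u - v)) + (\<Sum>v\<in>?U. count M (u - v))"
    unfolding toppled_Suc using disj by (subst sum.union_disjoint) auto
  moreover have "(step l l' (\<lambda>_. M) ^^ Suc t) c u =
      ?c u - (if ?c u \<ge> size M then size M else 0) + (\<Sum>v\<in>?U. count M (u - v))"
    using step_uniform[OF Suc.prems, of M ?c] by simp
  ultimately show ?case
    using Suc.IH[OF Suc.prems] once[of u] Suc.prems
    by (cases "u \<in> ?T"; cases "size M \<le> ?c u") (simp_all add: toppled_Suc stable_cell_def)
qed

lemma sum_received:
  fixes M :: neighborhood
  assumes "finite A" "finite P" "\<And>r. r \<notin> P \<Longrightarrow> count M r = 0"
  shows "(\<Sum>v\<in>A. count M (u - v)) = (\<Sum>r | r \<in> P \<and> u - r \<in> A. count M r)"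
proof -
  have "(\<Sum>v\<in>A. count M (u - v)) = (\<Sum>r\<in>(\<lambda>v. u - v) ` A. count M r)"
    by (subst sum.reindex) (auto simp: inj_on_def prod_eq_iff)
  also have "\<dots> = (\<Sum>r | r \<in> P \<and> u - r \<in> A. count M r)"
  proof (intro sum.mono_neutral_right subsetI ballI)
    fix r assume "r \<in> {r. r \<in> P \<and> u - r \<in> A}"
    then have "r = u - (u - r)" "u - r \<in> A" by simp_all
    then show "r \<in> (\<lambda>v. u - v) ` A" by (rule image_eqI)
  next
    fix r assume "r \<in> (\<lambda>v. u - v) ` A - {r. r \<in> P \<and> u - r \<in> A}"
    then have "r \<notin> P" by auto
    then show "count M r = 0" by (rule assms(3))
  qed (use assms(1) in simp)
  finally show ?thesis .
qed

lemma size_eq_sum_count: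
  assumes "finite P" "\<And>r. r \<notin> P \<Longrightarrow> count M r = 0"
  shows "size M = (\<Sum>r\<in>P. count M r)"
proof -
  have "set_mset M \<subseteq> P" using assms(2) by (metis count_eq_zero_iff subsetI)
  then show ?thesis
    unfolding size_multiset_overloaded_eq
    by (intro sum.mono_neutral_left assms) (auto simp: count_eq_zero_iff)
qed

lemma received_le:
  fixes M :: neighborhood
  assumes "finite A"
  shows "(\<Sum>v\<in>A. count M (u - v)) \<le> size M"
proof -
  have "(\<Sum>v\<in>A. count M (u - v)) = (\<Sum>r | r \<in> set_mset M \<and> u - r \<in> A. count M r)"
    by (rule sum_received) (auto simp: assms count_eq_zero_iff)
  also have "\<dots> \<le> size M"
    unfolding size_multiset_overloaded_eq by (intro sum_mono2) auto
  finally show ?thesis .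
qed

lemma received_less:
  fixes M :: neighborhood
  assumes "finite A" "r \<in># M" "u - r \<notin> A"
  shows "(\<Sum>v\<in>A. count M (u - v)) < size M"
proof -
  have "(\<Sum>v\<in>A. count M (u - v)) = (\<Sum>s | s \<in> set_mset M \<and> u - s \<in> A. count M s)"
    by (rule sum_received) (auto simp: assms count_eq_zero_iff)
  also have "\<dots> < size M"
    unfolding size_multiset_overloaded_eq using assms by (intro sum_strict_mono2[where b = r]) auto
  finally show ?thesis .
qed

text \<open>A stable cell holds less than \<open>size M\<close> grains and receives at most
  \<open>size M\<close>. At \<open>a\<close> the additional grain is offset by the vector
  \<open>r\<close>, whose source for \<open>a\<close> is outside the grid.\<close>

lemma add_grain_bound:
  assumes st: "stable l l' (\<lambda>_. M) c" and border: "r \<in># M" "a - r \<notin> cells l l'"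
    and u: "u \<in> cells l l'"
  shows "add_grain c a u + (\<Sum>v\<in>cells l l'. count M (u - v)) < 2 * size M"
proof -
  have c: "c u < size M" using st u by (simp add: stable_def stable_cell_def)
  show ?thesis
  proof (cases "u = a")
    case True
    then show ?thesis
      using received_less[OF finite_cells border] c by (simp add: add_grain_def)
  next
    case False
    then show ?thesis
      using received_le[OF finite_cells[of l l'], of M u] c by (simp add: add_grain_def)
  qed
qed

text \<open>A cell of the path lacks just what its predecessor sends, so toppling propagates along
  the path; all other cells remain stable even after the whole path has toppled.\<close>

lemma grain_carried_along:
  assumes fin: "finite P" and M: "\<And>r. r \<notin> P \<Longrightarrow> count M r = 0" "\<And>r. r \<in> P \<Longrightarrow> count M r \<ge> 1"
    and X: "inj_on X {..m}" "X ` {..m} \<subseteq> cells l l'" "\<And>k. k < m \<Longrightarrow> X (Suc k) - X k \<in> P"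
    and st: "stable l l' (\<lambda>_. M) c"
    and c0: "c (X 0) + 1 = size M"
    and cX: "\<And>k. k < m \<Longrightarrow> c (X (Suc k)) + count M (X (Suc k) - X k) = size M"
    and off: "\<And>u. u \<in> cells l l' - X ` {..m} \<Longrightarrow>
      c u + (\<Sum>r | r \<in> P \<and> u - r \<in> X ` {..m}. count M r) < size M"
    and border: "q \<in> P" "X 0 - q \<notin> cells l l'"
  shows "topples l l' (\<lambda>_. M) (add_grain c (X 0)) u \<longleftrightarrow> u \<in> X ` {..m}"
proof -
  define c' where "c' = add_grain c (X 0)"
  let ?T = "toppled l l' (\<lambda>_. M) c'"
  note rec = sum_received[where M = M, OF _ fin M(1)]
  have "q \<in># M" using M(2)[OF border(1)] by (metis count_eq_zero_iff not_one_le_zero)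
  then have bound: "c' u + (\<Sum>v\<in>cells l l'. count M (u - v)) < 2 * size M" if "u \<in> cells l l'" for u
    unfolding c'_def using add_grain_bound[OF st _ border(2) that] by blast
  note grains = uniform_grains[where c = c' and M = M, OF bound]
  have sub: "?T t \<subseteq> X ` {..m}" for t
  proof (induction t)
    case (Suc t)
    have "stable_cell (\<lambda>_. M) ((step l l' (\<lambda>_. M) ^^ t) c') u" if u: "u \<in> cells l l'" "u \<notin> X ` {..m}" for u
    proof -
      have "u \<noteq> X 0" "u \<notin> ?T t" using u Suc by auto
      then have "(step l l' (\<lambda>_. M) ^^ t) c' u = c u + (\<Sum>v\<in>?T t. count M (u - v))"
        using grains[OF _ u(1), of t] by (simp add: c'_def add_grain_def)
      also have "\<dots> \<le> c u + (\<Sum>v\<in>X ` {..m}. count M (u - v))"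
        using Suc by (intro add_left_mono sum_mono2) auto
      also have "\<dots> < size M"
        using off[of u] u by (simp add: rec)
      finally show ?thesis by (simp add: stable_cell_def)
    qed
    then show ?case using Suc by (auto simp: toppled_Suc)
  qed simp
  have all: "\<exists>t. X k \<in> ?T t" if "k \<le> m" for k
    using that
  proof (induction k)
    case 0
    have "\<not> stable_cell (\<lambda>_. M) ((step l l' (\<lambda>_. M) ^^ 0) c') (X 0)"
      using c0 by (simp add: stable_cell_def c'_def add_grain_def)
    then have "X 0 \<in> ?T (Suc 0)" unfolding toppled_Suc using X(2) by auto
    then show ?case ..
  next
    case (Suc k)
    then obtain t where t: "X k \<in> ?T t" by auto
    show ?case
    proof (cases "X (Suc k) \<in> ?T t")
      case False
      have cell: "X (Suc k) \<in> cells l l'" using X(2) Suc.prems by auto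
      have "X (Suc k) \<noteq> X 0" using X(1) Suc.prems by (auto dest: inj_onD)
      then have "(step l l' (\<lambda>_. M) ^^ t) c' (X (Suc k)) = c (X (Suc k)) + (\<Sum>v\<in>?T t. count M (X (Suc k) - v))"
        using grains[OF _ cell, of t] False by (simp add: c'_def add_grain_def)
      moreover have "count M (X (Suc k) - X k) \<le> (\<Sum>v\<in>?T t. count M (X (Suc k) - v))"
        using t by (intro member_le_sum) auto
      ultimately have "\<not> stable_cell (\<lambda>_. M) ((step l l' (\<lambda>_. M) ^^ t) c') (X (Suc k))"
        using cX[of k] Suc.prems by (simp add: stable_cell_def)
      then have "X (Suc k) \<in> ?T (Suc t)" unfolding toppled_Suc using cell by auto
      then show ?thesis ..
    qed blast
  qed
  show ?thesis
    unfolding topples_iff c'_def[symmetric] using sub all by auto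
qed

section \<open>Crossing routes from a pair of steering vectors\<close>

text \<open>By \<open>aff\<close> the linear part of \<open>\<theta>\<close> inverts
  \<open>\<phi>\<close>, and being a route depends only on differences and membership. It serves for
  the reflection in the diagonal and for placing routes in the actual grid.\<close>

lemma route_transport:
  assumes \<theta>: "bij \<theta>" and \<phi>: "inj \<phi>" and aff: "\<And>a r. \<theta> a - r = \<theta> (a - \<phi> r)"
    and rt: "route (\<phi> ` P) w m X B"
  shows "route P (w \<circ> \<phi>) m (\<theta> \<circ> X) (\<theta> ` B)"
proof -
  have inj: "inj \<theta>" and surj: "surj \<theta>" using \<theta> by (auto simp: bij_def)
  have mem: "\<theta> a - r \<in> \<theta> ` C \<longleftrightarrow> a - \<phi> r \<in> C" for a r C
    by (simp add: aff inj_image_mem_iff[OF inj])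
  have im: "(\<theta> \<circ> X) ` {..m} = \<theta> ` X ` {..m}" by (simp add: image_comp)
  note R = rt[unfolded route_def]
  show ?thesis
    unfolding route_def im
  proof (intro conjI allI impI ballI)
    show "inj_on (\<theta> \<circ> X) {..m}"
      using R inj by (auto intro: comp_inj_on inj_on_subset)
    show "\<theta> ` X ` {..m} \<inter> \<theta> ` B = {}"
      using R inj by (metis image_Int image_empty)
  next
    fix k assume k: "k < m"
    then obtain r where r: "r \<in> P" "X (Suc k) - X k = \<phi> r" using R by blast
    have "X k = X (Suc k) - \<phi> r" unfolding r(2)[symmetric] by simp
    then have "\<theta> (X k) = \<theta> (X (Suc k)) - r" by (simp add: aff)
    then have d: "(\<theta> \<circ> X) (Suc k) - (\<theta> \<circ> X) k = r" by simp
    then show "(\<theta> \<circ> X) (Suc k) - (\<theta> \<circ> X) k \<in> P" using r by simp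
    have "{r' \<in> \<phi> ` P. X (Suc k) - r' \<in> B} = \<phi> ` {s \<in> P. X (Suc k) - \<phi> s \<in> B}" by blast
    then have "(\<Sum>s | s \<in> \<phi> ` P \<and> X (Suc k) - s \<in> B. w s) = (\<Sum>s | s \<in> P \<and> X (Suc k) - \<phi> s \<in> B. w (\<phi> s))"
      using \<phi> by (simp add: sum.reindex inj_on_subset)
    moreover have "(\<Sum>s | s \<in> \<phi> ` P \<and> X (Suc k) - s \<in> B. w s) < w (\<phi> r)"
      unfolding r(2)[symmetric] using R k by blast
    ultimately show "(\<Sum>s | s \<in> P \<and> (\<theta> \<circ> X) (Suc k) - s \<in> \<theta> ` B. (w \<circ> \<phi>) s) <
      (w \<circ> \<phi>) ((\<theta> \<circ> X) (Suc k) - (\<theta> \<circ> X) k)"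
      unfolding d by (simp add: mem)
  next
    fix z
    obtain a where z: "z = \<theta> a" using surj by (metis surj_def)
    obtain r where "r \<in> P" "a - \<phi> r \<notin> X ` {..m}" using R by blast
    then show "\<exists>r\<in>P. z - r \<notin> \<theta> ` X ` {..m}" unfolding z mem by blast
  next
    fix r assume "r \<in> P"
    then show "(\<theta> \<circ> X) 0 - r \<notin> \<theta> ` B" using R by (simp add: mem)
  qed
qed

lemma ex_routes_cross_oriented:
  assumes fin: "finite P" and uv: "u \<in> P" "v \<in> P" "wedge u v > 0"
    and \<delta>: "fst \<delta> > 0" "snd \<delta> > 0" "wedge u \<delta> > 0" "wedge \<delta> v > 0"
    and jump: "wedge u v \<ge> 2 \<or> wedge u v = 1 \<and> (\<exists>p\<in>P. wedge p v \<le> -2)"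
  shows "\<exists>w m X n Y. (\<forall>r\<in>P. w r \<ge> 1) \<and> routes_cross P w m X n Y"
proof -
  obtain \<alpha> \<beta> \<alpha>' \<beta>' where pos: "\<alpha> > 0" "\<beta> > 0" "\<alpha>' > 0" "\<beta>' > 0"
    and D: "0 < fst (lin u v \<alpha>' \<beta>')" "fst (lin u v \<alpha>' \<beta>') < fst (lin u v \<alpha> \<beta>)"
      "0 < snd (lin u v \<alpha> \<beta>)" "snd (lin u v \<alpha> \<beta>) < snd (lin u v \<alpha>' \<beta>')"
    using ex_steering[OF \<delta> uv(3)] by blast
  have "\<exists>w. tracks_cross P w (\<alpha> + \<beta>) (lin u v \<alpha> \<beta>) (\<alpha>' + \<beta>') (lin u v \<alpha>' \<beta>')"
    using jump
  proof (elim disjE conjE bexE)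
    assume "wedge u v \<ge> 2"
    then show ?thesis using tracks_cross_sublattice[OF fin uv(1,2) _ pos] by blast
  next
    fix p assume 1: "wedge u v = 1" and p: "p \<in> P" "wedge p v \<le> -2"
    have "snd (lin u v \<alpha> \<beta>) * fst (lin u v \<alpha>' \<beta>') < fst (lin u v \<alpha> \<beta>) * snd (lin u v \<alpha>' \<beta>')"
      using D by (smt (verit) mult_strict_mono mult.commute)
    then have "wedge (lin u v \<alpha> \<beta>) (lin u v \<alpha>' \<beta>') > 0" by (simp add: wedge_def)
    moreover have "wedge (lin u v \<alpha> \<beta>) (lin u v \<alpha>' \<beta>') = (\<alpha> * \<beta>' - \<alpha>' * \<beta>) * wedge u v"
      by (simp add: wedge_def algebra_simps)
    ultimately have slope: "\<alpha>' * \<beta> < \<alpha> * \<beta>'" using 1 by simp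
    have "p = lin u v (- (- wedge p v)) (wedge u p)" using cramer_unimodular[OF 1] by simp
    then show ?thesis
      using tracks_cross_jump[OF fin uv(1,2) p(1) 1 _ _ pos slope] p(2) by (metis neg_le_iff_le minus_minus)
  qed
  then obtain w where w: "tracks_cross P w (\<alpha> + \<beta>) (lin u v \<alpha> \<beta>) (\<alpha>' + \<beta>') (lin u v \<alpha>' \<beta>')" ..
  then have "\<forall>r\<in>P. w r \<ge> 1" by (simp add: tracks_cross_def)
  moreover have "\<exists>m X n Y. routes_cross P w m X n Y"
    using routes_cross_of_tracks[OF fin w] pos D by auto
  ultimately show ?thesis by blast
qed

text \<open>The jump construction handles a \<open>u\<close>-coordinate at most -2. For a
  \<open>v\<close>-coordinate at most -2 the picture is reflected in the diagonal, which exchanges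
  \<open>u\<close> with \<open>v\<close> and the horizontal with the vertical route.\<close>

lemma ex_routes_cross:
  assumes fin: "finite P" and \<delta>: "fst \<delta> > 0" "snd \<delta> > 0"
    and D: "wedge D1 \<delta> > 0" "wedge \<delta> D2 > 0" "wedge D1 D2 > 0"
    and span: "\<And>x. (\<forall>p\<in>P. wedge x p \<le> 0) \<Longrightarrow> wedge x D1 \<le> 0 \<and> wedge x D2 \<le> 0"
    and generic: "\<And>p. p \<in> P \<Longrightarrow> wedge p \<delta> \<noteq> 0"
    and big: "p0 \<in> P" "q0 \<in> P" "\<bar>wedge p0 q0\<bar> \<ge> 2"
  shows "\<exists>w m X n Y. (\<forall>r\<in>P. w r \<ge> 1) \<and> routes_cross P w m X n Y"
proof -
  obtain u v where uv: "u \<in> P" "v \<in> P" "wedge u \<delta> > 0" "wedge \<delta> v > 0"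
    and cases: "wedge u v \<ge> 2 \<or> wedge u v = 1 \<and> (\<exists>p\<in>P. wedge p v \<le> -2 \<or> wedge u p \<le> -2)"
    using ex_crossing_pair[OF fin D span generic big] by blast
  show ?thesis
  proof (cases "wedge u v \<ge> 2 \<or> wedge u v = 1 \<and> (\<exists>p\<in>P. wedge p v \<le> -2)")
    case True
    then show ?thesis using ex_routes_cross_oriented[OF fin uv(1,2) _ \<delta> uv(3,4)] by auto
  next
    case False
    then obtain p where p: "p \<in> P" "wedge u p \<le> -2" and 1: "wedge u v = 1" using cases by blast
    let ?s = "prod.swap :: cell \<Rightarrow> cell"
    have ws: "wedge (?s x) (?s y) = wedge y x" for x y by (simp add: wedge_def)
    have "\<exists>w m X n Y. (\<forall>r\<in>?s ` P. w r \<ge> 1) \<and> routes_cross (?s ` P) w m X n Y"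
      by (rule ex_routes_cross_oriented[where u = "?s v" and v = "?s u" and \<delta> = "?s \<delta>"])
        (use fin uv \<delta> p 1 in \<open>auto simp: ws\<close>)
    then obtain w m X n Y where w: "\<forall>r\<in>?s ` P. w r \<ge> 1" and rc: "routes_cross (?s ` P) w m X n Y"
      by blast
    have aff: "?s a - r = ?s (a - ?s r)" for a r by (simp add: prod_eq_iff)
    note tp = route_transport[OF bij_swap inj_swap aff]
    have sw: "route P (w \<circ> ?s) m (?s \<circ> X) (?s ` Y ` {..n})"
      "route P (w \<circ> ?s) n (?s \<circ> Y) (?s ` X ` {..m})"
      using rc tp unfolding routes_cross_def by blast+
    have "routes_cross P (w \<circ> ?s) n (?s \<circ> Y) m (?s \<circ> X)"
      using sw rc unfolding routes_cross_def by (auto simp: image_comp)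
    moreover have "\<forall>r\<in>P. (w \<circ> ?s) r \<ge> 1" using w by simp
    ultimately show ?thesis by blast
  qed
qed

text \<open>In the configuration each cell misses exactly the grains sent by its predecessor on its route.\<close>

lemma ex_config_of_routes:
  assumes fin: "finite P" and w: "\<And>r. r \<in> P \<Longrightarrow> w r \<ge> 1"
    and M: "\<And>r. count M r = (if r \<in> P then w r else 0)"
    and X: "route P w m X (Y ` {..n})" "X ` {..m} \<subseteq> cells l l'" "q \<in> P" "X 0 - q \<notin> cells l l'"
    and Y: "route P w n Y (X ` {..m})" "Y ` {..n} \<subseteq> cells l l'" "q' \<in> P" "Y 0 - q' \<notin> cells l l'"
  shows "\<exists>c. stable l l' (\<lambda>_. M) c \<and>
    (\<forall>u. topples l l' (\<lambda>_. M) (add_grain c (X 0)) u \<longleftrightarrow> u \<in> X ` {..m}) \<and>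
    (\<forall>u. topples l l' (\<lambda>_. M) (add_grain c (Y 0)) u \<longleftrightarrow> u \<in> Y ` {..n})"
proof -
  define need where "need Z k = (case k of 0 \<Rightarrow> 1 | Suc j \<Rightarrow> w (Z (Suc j) - Z j))" for Z :: "nat \<Rightarrow> cell" and k
  define c where "c u = (if u \<in> X ` {..m} then size M - need X (the_inv_into {..m} X u)
    else if u \<in> Y ` {..n} then size M - need Y (the_inv_into {..n} Y u) else 0)" for u
  note RX = X(1)[unfolded route_def] and RY = Y(1)[unfolded route_def]
  have inj: "inj_on X {..m}" "inj_on Y {..n}" using RX RY by blast+
  have disj: "X ` {..m} \<inter> Y ` {..n} = {}" using RX by blast
  have stepX: "X (Suc k) - X k \<in> P"
    "(\<Sum>r | r \<in> P \<and> X (Suc k) - r \<in> Y ` {..n}. w r) < w (X (Suc k) - X k)" if "k < m" for k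
    using RX that by blast+
  have stepY: "Y (Suc k) - Y k \<in> P"
    "(\<Sum>r | r \<in> P \<and> Y (Suc k) - r \<in> X ` {..m}. w r) < w (Y (Suc k) - Y k)" if "k < n" for k
    using RY that by blast+
  have size: "size M = (\<Sum>r\<in>P. w r)"
    using size_eq_sum_count[OF fin, of M] by (simp add: M)
  have w_le: "w r \<le> size M" if "r \<in> P" for r
    unfolding size using that fin by (intro member_le_sum) auto
  have size1: "size M \<ge> 1" using w_le[OF X(3)] w[OF X(3)] by linarith
  have needX: "need X k \<le> size M" "1 \<le> need X k" if "k \<le> m" for k
    using that w_le[OF stepX(1)] w[OF stepX(1)] size1 by (auto simp: need_def split: nat.split)
  have needY: "need Y k \<le> size M" "1 \<le> need Y k" if "k \<le> n" for k
    using that w_le[OF stepY(1)] w[OF stepY(1)] size1 by (auto simp: need_def split: nat.split)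
  have cX: "c (X k) + need X k = size M" if "k \<le> m" for k
    using needX[OF that] the_inv_into_f_f[OF inj(1), of k] that by (simp add: c_def)
  have cY: "c (Y k) + need Y k = size M" if "k \<le> n" for k
  proof -
    have "Y k \<notin> X ` {..m}" using disj that by auto
    then show ?thesis
      using needY[OF that] the_inv_into_f_f[OF inj(2), of k] that by (simp add: c_def)
  qed
  have c0: "c u = 0" if "u \<notin> X ` {..m}" "u \<notin> Y ` {..n}" for u
    using that by (simp add: c_def)
  have st: "stable l l' (\<lambda>_. M) c"
    unfolding stable_def stable_cell_def
  proof
    fix u
    show "c u < size M"
    proof (cases "u \<in> X ` {..m} \<or> u \<in> Y ` {..n}")
      case True
      then show ?thesis using cX cY needX(2) needY(2) by fastforce
    qed (use c0 size1 in auto)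
  qed
  have partial: "(\<Sum>r | r \<in> P \<and> u - r \<in> A. w r) < size M" if "r0 \<in> P" "u - r0 \<notin> A" for u r0 A
    unfolding size using that fin w[OF that(1)] by (intro sum_strict_mono2[where b = r0]) auto
  have cntM: "(\<Sum>r | r \<in> P \<and> u - r \<in> A. count M r) = (\<Sum>r | r \<in> P \<and> u - r \<in> A. w r)" for u A
    by (intro sum.cong) (auto simp: M)
  \<comment> \<open>A cell of \<open>Y\<close> lacks more than \<open>X\<close> can send it, by the
    weight condition of its route; a cell on neither route is empty and has a predecessor off
    \<open>X\<close>.\<close>
  have offX: "c u + (\<Sum>r | r \<in> P \<and> u - r \<in> X ` {..m}. w r) < size M" if "u \<notin> X ` {..m}" for u
  proof (cases "u \<in> Y ` {..n}")
    case True
    then obtain k where k: "k \<le> n" "u = Y k" by auto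
    have "(\<Sum>r | r \<in> P \<and> Y k - r \<in> X ` {..m}. w r) < need Y k"
    proof (cases k)
      case 0
      have "\<forall>r\<in>P. Y 0 - r \<notin> X ` {..m}" using RY by blast
      then have "{r. r \<in> P \<and> Y k - r \<in> X ` {..m}} = {}" using 0 by blast
      then show ?thesis unfolding need_def using 0 by (simp only: sum.empty nat.case)
    next
      case (Suc j)
      then show ?thesis using stepY(2)[of j] k by (simp add: need_def)
    qed
    then show ?thesis using cY[OF k(1)] k(2) by simp
  next
    case False
    obtain r where "r \<in> P" "u - r \<notin> X ` {..m}" using RX by blast
    then show ?thesis using c0[OF that False] partial by simp
  qed
  have offY: "c u + (\<Sum>r | r \<in> P \<and> u - r \<in> Y ` {..n}. w r) < size M" if "u \<notin> Y ` {..n}" for u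
  proof (cases "u \<in> X ` {..m}")
    case True
    then obtain k where k: "k \<le> m" "u = X k" by auto
    have "(\<Sum>r | r \<in> P \<and> X k - r \<in> Y ` {..n}. w r) < need X k"
    proof (cases k)
      case 0
      have "\<forall>r\<in>P. X 0 - r \<notin> Y ` {..n}" using RX by blast
      then have "{r. r \<in> P \<and> X k - r \<in> Y ` {..n}} = {}" using 0 by blast
      then show ?thesis unfolding need_def using 0 by (simp only: sum.empty nat.case)
    next
      case (Suc j)
      then show ?thesis using stepX(2)[of j] k by (simp add: need_def)
    qed
    then show ?thesis using cX[OF k(1)] k(2) by simp
  next
    case False
    obtain r where "r \<in> P" "u - r \<notin> Y ` {..n}" using RY by blast
    then show ?thesis using c0[OF False that] partial by simp
  qed
  have "topples l l' (\<lambda>_. M) (add_grain c (X 0)) u \<longleftrightarrow> u \<in> X ` {..m}" for u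
  proof (rule grain_carried_along[OF fin, where q = q])
    show "c (X (Suc k)) + count M (X (Suc k) - X k) = size M" if "k < m" for k
      using cX[of "Suc k"] stepX(1)[OF that] that by (simp add: need_def M)
    show "c (X 0) + 1 = size M" using cX[of 0] by (simp add: need_def)
  qed (use inj stepX(1) X(2-4) M w st offX in \<open>auto simp: cntM\<close>)
  moreover have "topples l l' (\<lambda>_. M) (add_grain c (Y 0)) u \<longleftrightarrow> u \<in> Y ` {..n}" for u
  proof (rule grain_carried_along[OF fin, where q = q'])
    show "c (Y (Suc k)) + count M (Y (Suc k) - Y k) = size M" if "k < n" for k
      using cY[of "Suc k"] stepY(1)[OF that] that by (simp add: need_def M)
    show "c (Y 0) + 1 = size M" using cY[of 0] by (simp add: need_def)
  qed (use inj stepY(1) Y(2-4) M w st offY in \<open>auto simp: cntM\<close>)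
  ultimately show ?thesis using st by blast
qed

section \<open>Crossing routes from disjoint walks\<close>

definition walk_rel :: "cell set \<Rightarrow> cell set \<Rightarrow> (cell \<times> cell) set" where
  "walk_rel P S = {(x, y). x \<in> S \<and> y \<in> S \<and> y - x \<in> P}"

text \<open>The functionals \<open>wedge x\<close> express by duality that the displacement of a
  walk lies in the cone spanned by \<open>P\<close>; this yields the hypothesis \<open>span\<close>
  used to find the steering vectors.\<close>

lemma wedge_walk:
  assumes "(a, c) \<in> (walk_rel P S)\<^sup>*" "\<forall>p\<in>P. wedge x p \<le> 0"
  shows "wedge x (c - a) \<le> 0"
  using assms(1)
proof (induction rule: rtrancl_induct)
  case (step c d)
  have "wedge x (d - c) \<le> 0" using step(2) assms(2) by (auto simp: walk_rel_def)
  then show ?case using step.IH by (simp add: wedge_diff_right)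
qed (simp add: wedge_def)

section \<open>Polygonal paths and crossing segments\<close>

definition point :: "cell \<Rightarrow> real^2" where
  "point z = vector [of_int (fst z), of_int (snd z)]"

lemma point_nth [simp]: "point z $ 1 = of_int (fst z)" "point z $ 2 = of_int (snd z)"
  by (simp_all add: point_def)

text \<open>The start is inserted for the sake of the empty walk, which has no segment.\<close>

lemma polygonal_path:
  assumes "(a, c) \<in> (walk_rel P S)\<^sup>*"
  shows "\<exists>g. path g \<and> pathstart g = point a \<and> pathfinish g = point c \<and>
    path_image g \<subseteq> insert (point a) (\<Union>(x, y)\<in>walk_rel P S. closed_segment (point x) (point y))"
  using assms
proof (induction rule: rtrancl_induct)
  case base
  show ?case
    by (rule exI[of _ "linepath (point a) (point a)"])
      (simp only: path_linepath pathstart_linepath pathfinish_linepath path_image_linepath, simp)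
next
  case (step c d)
  then obtain g where g: "path g" "pathstart g = point a" "pathfinish g = point c"
    "path_image g \<subseteq> insert (point a) (\<Union>(x, y)\<in>walk_rel P S. closed_segment (point x) (point y))" by blast
  have "path_image (g +++ linepath (point c) (point d)) \<subseteq>
    path_image g \<union> closed_segment (point c) (point d)"
    using g by (simp add: path_image_join)
  also have "\<dots> \<subseteq> insert (point a) (\<Union>(x, y)\<in>walk_rel P S. closed_segment (point x) (point y))"
    using g(4) step(2) by blast
  finally show ?case
    using g by (intro exI[of _ "g +++ linepath (point c) (point d)"]) simp
qed

lemma of_int_in_unit_interval:
  assumes "0 \<le> (of_int k :: real)" "(of_int k :: real) \<le> 1"
  shows "k = 0 \<or> k = 1"
  using assms by (simp, linarith)

text \<open>
  If the determinants were all at most 1 in absolute value, then the segments could only meet at lattice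
  points that are end points of both.
\<close>

lemma large_wedge_of_crossing_segments:
  fixes s t :: real
  assumes st: "0 \<le> s" "s \<le> 1" "0 \<le> t" "t \<le> 1"
    and eq: "of_int (fst x) + s * of_int (fst p) = of_int (fst y) + t * of_int (fst q)"
      "of_int (snd x) + s * of_int (snd p) = of_int (snd y) + t * of_int (snd q)"
    and ends: "x \<noteq> y" "x + p \<noteq> y" "x \<noteq> y + q" "x + p \<noteq> y + q"
    and ne: "q \<noteq> (0, 0)" "wedge p r \<noteq> 0"
  shows "\<bar>wedge p q\<bar> \<ge> 2 \<or> \<bar>wedge p r\<bar> \<ge> 2 \<or> \<bar>wedge q r\<bar> \<ge> 2"
proof (rule ccontr)
  assume "\<not> ?thesis"
  then have small: "\<bar>wedge p q\<bar> \<le> 1" "\<bar>wedge p r\<bar> = 1" "\<bar>wedge q r\<bar> \<le> 1" using ne by auto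
  define d where "d = y - x"
  have d: "s * of_int (fst p) - t * of_int (fst q) = of_int (fst d)"
    "s * of_int (snd p) - t * of_int (snd q) = of_int (snd d)"
    using eq by (simp_all add: d_def)
  have dends: "d \<noteq> (0, 0)" "d \<noteq> p" "d + q \<noteq> (0, 0)" "d + q \<noteq> p"
    using ends by (auto simp: d_def prod_eq_iff)
  have sw: "s * of_int (wedge p q) = of_int (wedge d q)" "t * of_int (wedge p q) = of_int (wedge d p)"
    unfolding wedge_def of_int_diff of_int_mult d[symmetric] by (simp_all add: algebra_simps)
  show False
  proof (cases "wedge p q = 0")
    case False
    \<comment> \<open>By Cramer's rule both parameters are integers, so the segments meet at end
      points of both.\<close>
    then have "wedge p q = 1 \<or> wedge p q = -1" using small by auto
    then have "s = of_int (wedge p q * wedge d q)" "t = of_int (wedge p q * wedge d p)"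
      using sw by auto
    then have "(s = 0 \<or> s = 1) \<and> (t = 0 \<or> t = 1)"
      using st of_int_in_unit_interval by (metis of_int_0 of_int_1)
    then show False
      using d dends by (auto simp: prod_eq_iff simp flip: of_int_diff of_int_minus)
  next
    \<comment> \<open>Now \<open>p\<close> and \<open>q\<close> are parallel. As
      \<open>wedge p r\<close> is 1 or -1, \<open>p\<close> is primitive, so \<open>d\<close> and
      \<open>q\<close> are integer multiples \<open>k\<close> and \<open>l\<close> of
      \<open>p\<close>, and the bound on \<open>wedge q r\<close> leaves \<open>l = 1\<close> or
      \<open>l = -1\<close>. Each \<open>k\<close> that remains makes two end points
      coincide.\<close>
    case True
    have cr: "wedge p r * fst z = wedge z r * fst p + wedge p z * fst r"
      "wedge p r * snd z = wedge z r * snd p + wedge p z * snd r" for z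
      by (simp_all add: wedge_def algebra_simps)
    have p0: "p \<noteq> (0, 0)" using ne(2) by (auto simp: wedge_def)
    have pd: "wedge p d = 0" using sw True by (simp add: wedge_swap[of d p] del: of_int_minus)
    define e where "e = wedge p r"
    have e: "e * e = 1" using small(2) by (auto simp: e_def abs_if split: if_splits)
    define k where "k = e * wedge d r"
    define l where "l = e * wedge q r"
    have "e * (e * fst d) = e * (wedge d r * fst p)" "e * (e * snd d) = e * (wedge d r * snd p)"
      "e * (e * fst q) = e * (wedge q r * fst p)" "e * (e * snd q) = e * (wedge q r * snd p)"
      using cr[of d] cr[of q] True pd by (simp_all add: e_def)
    then have dk: "fst d = k * fst p" "snd d = k * snd p" "fst q = l * fst p" "snd q = l * snd p"
      using e by (simp_all add: k_def l_def mult.assoc[symmetric])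
    have "l \<noteq> 0" using dk(3,4) ne(1) by (auto simp: prod_eq_iff)
    moreover have "\<bar>l\<bar> \<le> 1" using small e by (simp add: l_def e_def abs_mult)
    ultimately have l: "l = 1 \<or> l = -1" by auto
    have "(of_int k - (s - t * of_int l)) * (of_int (fst p) :: real) = 0"
      "(of_int k - (s - t * of_int l)) * (of_int (snd p) :: real) = 0"
      using d unfolding dk by (simp_all add: algebra_simps)
    then have kst: "of_int k = s - t * of_int l" using p0 by (auto simp: prod_eq_iff)
    from l show False
    proof
      assume l: "l = 1"
      then have "k = -1 \<or> k = 0 \<or> k = 1" using kst st by (simp, linarith)
      then show False using dk dends l by (auto simp: prod_eq_iff)
    next
      assume l: "l = -1"
      then have "k = 0 \<or> k = 1 \<or> k = 2" using kst st by (simp, linarith)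
      then show False using dk dends l by (auto simp: prod_eq_iff)
    qed
  qed
qed

text \<open>\<open>nonpar\<close> provides the third vector for the case that the two crossing steps
  are parallel, where their own determinant says nothing.\<close>

lemma large_wedge_of_walks:
  assumes disj: "S \<inter> S' = {}" and P0: "(0, 0) \<notin> P"
    and walk: "(a, a') \<in> (walk_rel P S)\<^sup>*" "(b, b') \<in> (walk_rel P S')\<^sup>*"
    and box: "\<And>z. z \<in> S \<union> S' \<Longrightarrow> x0 \<le> fst z \<and> fst z \<le> x1 \<and> y0 \<le> snd z \<and> snd z \<le> y1"
    and ends: "fst a = x0" "fst a' = x1" "snd b = y0" "snd b' = y1" "a \<noteq> a'" "b \<noteq> b'"
    and nonpar: "\<And>p. p \<in> P \<Longrightarrow> \<exists>r\<in>P. wedge p r \<noteq> 0"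
  shows "\<exists>p\<in>P. \<exists>q\<in>P. \<bar>wedge p q\<bar> \<ge> 2"
proof -
  define seg where "seg S = (\<Union>(x, y)\<in>walk_rel P S. closed_segment (point x) (point y))" for S
  have path: "\<exists>g. path g \<and> pathstart g = point c \<and> pathfinish g = point d \<and> path_image g \<subseteq> seg S"
    if cd: "(c, d) \<in> (walk_rel P S)\<^sup>*" "c \<noteq> d" for c d S
  proof -
    obtain e where e: "(c, e) \<in> walk_rel P S"
      using converse_rtranclE[OF cd(1)] cd(2) by blast
    have "point c \<in> closed_segment (point c) (point e)" by simp
    then have "point c \<in> seg S" unfolding seg_def using e by blast
    then have "insert (point c) (seg S) = seg S" by blast
    with polygonal_path[OF cd(1), folded seg_def] show ?thesis by simp
  qed
  obtain f where f: "path f" "pathstart f = point a" "pathfinish f = point a'" "path_image f \<subseteq> seg S"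
    using path[OF walk(1) ends(5)] by blast
  obtain g where g: "path g" "pathstart g = point b" "pathfinish g = point b'" "path_image g \<subseteq> seg S'"
    using path[OF walk(2) ends(6)] by blast
  let ?lo = "point (x0, y0)" and ?hi = "point (x1, y1)"
  have pt: "point z \<in> cbox ?lo ?hi" if "z \<in> S \<union> S'" for z
    using box[OF that] by (simp add: mem_box_cart forall_2)
  have "closed_segment (point x) (point y) \<subseteq> cbox ?lo ?hi" if "x \<in> S \<union> S'" "y \<in> S \<union> S'" for x y
    using that by (intro closed_segment_subset pt convex_box)
  then have "seg S \<subseteq> cbox ?lo ?hi" "seg S' \<subseteq> cbox ?lo ?hi"
    unfolding seg_def walk_rel_def by blast+
  then have sub: "path_image f \<subseteq> cbox ?lo ?hi" "path_image g \<subseteq> cbox ?lo ?hi"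
    using f(4) g(4) by blast+
  obtain z where "z \<in> path_image f" "z \<in> path_image g"
    by (rule fashoda[OF f(1) g(1) sub]) (simp_all add: f g ends)
  then obtain x x' y y' where xy: "(x, x') \<in> walk_rel P S" "(y, y') \<in> walk_rel P S'"
    and z: "z \<in> closed_segment (point x) (point x')" "z \<in> closed_segment (point y) (point y')"
    using f(4) g(4) unfolding seg_def by blast
  define p where "p = x' - x"
  define q where "q = y' - y"
  have pq: "p \<in> P" "q \<in> P" and S: "x \<in> S" "x' \<in> S" "y \<in> S'" "y' \<in> S'"
    using xy by (auto simp: walk_rel_def p_def q_def)
  obtain s t where st: "0 \<le> s" "s \<le> 1" "0 \<le> t" "t \<le> 1"
    and eq: "(1 - s) *\<^sub>R point x + s *\<^sub>R point x' = (1 - t) *\<^sub>R point y + t *\<^sub>R point y'"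
    using z by (auto simp: closed_segment_def)
  have eq': "of_int (fst x) + s * of_int (fst p) = of_int (fst y) + t * of_int (fst q)"
    "of_int (snd x) + s * of_int (snd p) = of_int (snd y) + t * of_int (snd q)"
    using arg_cong[OF eq, of "\<lambda>v. v $ 1"] arg_cong[OF eq, of "\<lambda>v. v $ 2"]
    by (simp_all add: p_def q_def algebra_simps)
  have ne: "x \<noteq> y" "x + p \<noteq> y" "x \<noteq> y + q" "x + p \<noteq> y + q"
    using S disj by (auto simp: p_def q_def)
  have "q \<noteq> (0, 0)" using pq P0 by auto
  moreover obtain r where "r \<in> P" "wedge p r \<noteq> 0" using nonpar pq by blast
  ultimately show ?thesis
    using large_wedge_of_crossing_segments[OF st eq' ne] pq by blast
qed

lemma ex_routes_cross_of_walks: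
  assumes fin: "finite P" and P0: "(0, 0) \<notin> P" and disj: "S \<inter> S' = {}"
    and walk: "(a, a') \<in> (walk_rel P S)\<^sup>*" "(b, b') \<in> (walk_rel P S')\<^sup>*"
    and box: "\<And>z. z \<in> S \<union> S' \<Longrightarrow> x0 \<le> fst z \<and> fst z \<le> x1 \<and> y0 \<le> snd z \<and> snd z \<le> y1"
    and ends: "fst a = x0" "fst a' = x1" "snd b = y0" "snd b' = y1"
    and inner: "y0 < snd a" "snd a < y1" "x0 < fst b" "fst b < x1"
    and inS: "a' \<in> S" "b' \<in> S'"
  shows "\<exists>w m X n Y. (\<forall>r\<in>P. w r \<ge> 1) \<and> routes_cross P w m X n Y"
proof -
  define W where "W = x1 - x0"
  define h where "h = y1 - y0"
  define D1 where "D1 = a' - a"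
  define D2 where "D2 = b' - b"
  \<comment> \<open>\<open>k\<close> exceeds every \<open>\<bar>snd p\<bar>\<close>, so a nonzero
    determinant of \<open>p\<close> with the diagonal cannot be cancelled by the perturbation, and
    every element of \<open>P\<close> falls strictly on one side of \<open>\<delta>\<close>. It also
    exceeds \<open>h\<close>, so \<open>D1\<close> stays on its side.\<close>
  define k where "k = 1 + h + (\<Sum>p\<in>P. \<bar>snd p\<bar>)"
  \<comment> \<open>a perturbation of the diagonal \<open>(W, h)\<close> of the box that is not parallel to any element of \<open>P\<close>\<close>
  define \<delta> where "\<delta> = (W * k + 1, h * k)"
  have Wh: "W > 0" "h > 0" using inner by (auto simp: W_def h_def)
  have D1: "fst D1 = W" "\<bar>snd D1\<bar> < h"
    using ends inner box[of a'] inS by (auto simp: D1_def W_def h_def)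
  have D2: "snd D2 = h" "\<bar>fst D2\<bar> < W"
    using ends inner box[of b'] inS by (auto simp: D2_def W_def h_def)
  have k: "k > h" "k > 0" and kp: "\<And>p. p \<in> P \<Longrightarrow> \<bar>snd p\<bar> < k"
  proof -
    have nonneg: "(\<Sum>p\<in>P. \<bar>snd p\<bar>) \<ge> 0" by (intro sum_nonneg) simp
    then show "k > h" "k > 0" unfolding k_def using Wh by linarith+
    show "\<bar>snd p\<bar> < k" if "p \<in> P" for p
      using member_le_sum[OF that _ fin, of "\<lambda>p. \<bar>snd p\<bar>"] Wh by (auto simp: k_def)
  qed
  have \<delta>: "fst \<delta> > 0" "snd \<delta> > 0" using Wh k by (simp_all add: \<delta>_def add_pos_pos)
  have "1 * 1 \<le> W * (h - snd D1)" using Wh D1 by (intro mult_mono) auto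
  then have "1 * k \<le> (W * (h - snd D1)) * k" using k by (intro mult_right_mono) auto
  moreover have "wedge D1 \<delta> = (W * (h - snd D1)) * k - snd D1"
    by (simp add: wedge_def D1 \<delta>_def algebra_simps)
  ultimately have w1: "wedge D1 \<delta> > 0" using D1 k by linarith
  have "0 \<le> (h * k) * (W - fst D2)" using Wh k D2 by (intro mult_nonneg_nonneg) auto
  moreover have "wedge \<delta> D2 = (h * k) * (W - fst D2) + h"
    by (simp add: wedge_def D2 \<delta>_def algebra_simps)
  ultimately have w2: "wedge \<delta> D2 > 0" using Wh by linarith
  have "\<bar>snd D1\<bar> * \<bar>fst D2\<bar> < h * W" using D1 D2 by (intro mult_strict_mono) auto
  then have "\<bar>snd D1 * fst D2\<bar> < h * W" by (simp add: abs_mult)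
  then have w12: "wedge D1 D2 > 0" by (simp add: wedge_def D1 D2 mult.commute)
  have span: "wedge x D1 \<le> 0 \<and> wedge x D2 \<le> 0" if "\<forall>p\<in>P. wedge x p \<le> 0" for x
    using wedge_walk[OF walk(1) that] wedge_walk[OF walk(2) that] by (simp add: D1_def D2_def)
  have generic: "wedge p \<delta> \<noteq> 0" if p: "p \<in> P" for p
  proof
    assume "wedge p \<delta> = 0"
    then have e: "(fst p * h - snd p * W) * k = snd p" by (simp add: wedge_def \<delta>_def algebra_simps)
    have "fst p * h - snd p * W = 0"
    proof (rule ccontr)
      assume "fst p * h - snd p * W \<noteq> 0"
      then have "1 * k \<le> \<bar>fst p * h - snd p * W\<bar> * k" using k by (intro mult_right_mono) auto
      also have "\<dots> = \<bar>snd p\<bar>" using e k by (metis abs_mult abs_of_pos)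
      finally show False using kp[OF p] by simp
    qed
    with e have "snd p = 0" "fst p = 0" using Wh by auto
    then show False using p P0 by (metis prod.collapse)
  qed
  \<comment> \<open>If all of \<open>P\<close> were parallel to \<open>p\<close>, so would be the
    independent displacements \<open>D1\<close> and \<open>D2\<close>.\<close>
  have nonpar: "\<exists>r\<in>P. wedge p r \<noteq> 0" if p: "p \<in> P" for p
  proof (rule ccontr)
    assume "\<not> ?thesis"
    then have "\<forall>r\<in>P. wedge p r \<le> 0" "\<forall>r\<in>P. wedge (- p) r \<le> 0" by (auto simp: wedge_def)
    then have "wedge p D1 \<le> 0 \<and> wedge p D2 \<le> 0" "wedge (- p) D1 \<le> 0 \<and> wedge (- p) D2 \<le> 0"
      using span by blast+
    then have "wedge p D1 = 0" "wedge p D2 = 0" by (auto simp: wedge_def)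
    moreover have "wedge D1 D2 * fst p = fst D1 * wedge p D2 - fst D2 * wedge p D1"
      "wedge D1 D2 * snd p = snd D1 * wedge p D2 - snd D2 * wedge p D1"
      by (simp_all add: wedge_def algebra_simps)
    ultimately have "fst p = 0" "snd p = 0" using w12 by auto
    then show False using p P0 by (metis prod.collapse)
  qed
  have "a \<noteq> a'" "b \<noteq> b'" using ends inner by auto
  from large_wedge_of_walks[OF disj P0 walk box ends this nonpar]
  obtain p q where "p \<in> P" "q \<in> P" "\<bar>wedge p q\<bar> \<ge> 2" by blast
  then show ?thesis
    using ex_routes_cross[OF fin \<delta> w1 w2 w12 span generic] by blast
qed

section \<open>Orientation\<close>

text \<open>
  In the coordinates \<open>(height A', height B')\<close> the four sides \<open>A\<close>, \<open>A'\<close>, \<open>B\<close>, \<open>B'\<close> become West, East,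
  South, North.
\<close>

fun height :: "direction \<Rightarrow> cell \<Rightarrow> int" where
  "height North z = snd z"
| "height South z = - snd z"
| "height East z = fst z"
| "height West z = - fst z"

fun lowest :: "nat \<Rightarrow> nat \<Rightarrow> direction \<Rightarrow> int" where
  "lowest l l' North = 1"
| "lowest l l' South = - int l'"
| "lowest l l' East = 1"
| "lowest l l' West = - int l"

fun highest :: "nat \<Rightarrow> nat \<Rightarrow> direction \<Rightarrow> int" where
  "highest l l' North = int l'"
| "highest l l' South = - 1"
| "highest l l' East = int l"
| "highest l l' West = - 1"

definition oriented :: "direction \<Rightarrow> direction \<Rightarrow> direction \<Rightarrow> direction \<Rightarrow> bool" where
  "oriented A A' B B' \<longleftrightarrow> {{A, A'}, {B, B'}} = {{North, South}, {West, East}}"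

lemma height_add: "height D (x + y) = height D x + height D y"
  and height_diff: "height D (x - y) = height D x - height D y"
  by (cases D; simp)+

lemma height_zero [simp]: "height D (0, 0) = 0"
  by (cases D) simp_all

lemma oriented_cases:
  assumes "oriented A A' B B'"
  shows "(A, A', B, B') \<in>
    {(North, South, West, East), (North, South, East, West), (South, North, West, East), (South, North, East, West),
     (West, East, North, South), (West, East, South, North), (East, West, North, South), (East, West, South, North)}"
  using assms unfolding oriented_def
  by (cases A; cases A'; cases B; cases B'; simp add: doubleton_eq_iff)

lemma edge_iff: "z \<in> edge l l' D \<longleftrightarrow> z \<in> cells l l' \<and> height D z = highest l l' D"
  by (cases D) auto

lemma opposite_edges:
  assumes "oriented A A' B B'"
  shows "height A z = - height A' z" "highest l l' A = - lowest l l' A'"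
    "height B z = - height B' z" "highest l l' B = - lowest l l' B'"
  using oriented_cases[OF assms] by (elim insertE; simp add: Suc_le_eq)+

lemma corners_iff:
  assumes "oriented A A' B B'"
  shows "z \<in> corners l l' \<longleftrightarrow> (z \<in> edge l l' A \<or> z \<in> edge l l' A') \<and> (z \<in> edge l l' B \<or> z \<in> edge l l' B')"
  unfolding corners_def using oriented_cases[OF assms]
  by (elim insertE; simp del: edge.simps; blast)

lemma cells_iff:
  assumes "oriented A A' B B'"
  shows "z \<in> cells l l' \<longleftrightarrow> lowest l l' A' \<le> height A' z \<and> height A' z \<le> highest l l' A' \<and>
      lowest l l' B' \<le> height B' z \<and> height B' z \<le> highest l l' B'"
  unfolding cells_def mem_Times_iff using oriented_cases[OF assms]
  by (elim insertE; simp; linarith)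

lemma opposite_edge_iff:
  assumes "oriented A A' B B'"
  shows "z \<in> edge l l' A \<longleftrightarrow> z \<in> cells l l' \<and> height A' z = lowest l l' A'"
    and "z \<in> edge l l' B \<longleftrightarrow> z \<in> cells l l' \<and> height B' z = lowest l l' B'"
  by (auto simp: edge_iff opposite_edges[OF assms])

lemma non_corner_iff:
  assumes "oriented A A' B B'"
  shows "z \<in> edge l l' A - corners l l' \<longleftrightarrow> z \<in> cells l l' \<and> height A' z = lowest l l' A' \<and>
      lowest l l' B' < height B' z \<and> height B' z < highest l l' B'"
    and "z \<in> edge l l' B - corners l l' \<longleftrightarrow> z \<in> cells l l' \<and> height B' z = lowest l l' B' \<and>
      lowest l l' A' < height A' z \<and> height A' z < highest l l' A'"
  unfolding Diff_iff corners_iff[OF assms] opposite_edge_iff[OF assms]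
  unfolding edge_iff
  using cells_iff[OF assms, of z] by auto

definition frame :: "direction \<Rightarrow> direction \<Rightarrow> cell \<Rightarrow> cell" where
  "frame A' B' z = (height A' z, height B' z)"

lemma frame_simps [simp]: "fst (frame A' B' z) = height A' z" "snd (frame A' B' z) = height B' z"
  by (simp_all add: frame_def)

lemma frame_diff: "frame A' B' (x - y) = frame A' B' x - frame A' B' y"
  by (simp add: frame_def height_diff)

lemma bij_frame:
  assumes "oriented A A' B B'"
  shows "bij (frame A' B')"
proof -
  have "\<exists>g. \<forall>z. g (frame A' B' z) = z \<and> frame A' B' (g z) = z"
    using oriented_cases[OF assms]
  proof (elim insertE)
    assume "(A, A', B, B') = (North, South, West, East)"
    then show ?thesis by (intro exI[of _ "\<lambda>z. (snd z, - fst z)"]) (simp add: frame_def)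
  next
    assume "(A, A', B, B') = (North, South, East, West)"
    then show ?thesis by (intro exI[of _ "\<lambda>z. (- snd z, - fst z)"]) (simp add: frame_def)
  next
    assume "(A, A', B, B') = (South, North, West, East)"
    then show ?thesis by (intro exI[of _ "\<lambda>z. (snd z, fst z)"]) (simp add: frame_def)
  next
    assume "(A, A', B, B') = (South, North, East, West)"
    then show ?thesis by (intro exI[of _ "\<lambda>z. (- snd z, fst z)"]) (simp add: frame_def)
  next
    assume "(A, A', B, B') = (West, East, North, South)"
    then show ?thesis by (intro exI[of _ "\<lambda>z. (fst z, - snd z)"]) (simp add: frame_def)
  next
    assume "(A, A', B, B') = (West, East, South, North)"
    then show ?thesis by (intro exI[of _ "\<lambda>z. (fst z, snd z)"]) (simp add: frame_def)
  next
    assume "(A, A', B, B') = (East, West, North, South)"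
    then show ?thesis by (intro exI[of _ "\<lambda>z. (- fst z, - snd z)"]) (simp add: frame_def)
  next
    assume "(A, A', B, B') = (East, West, South, North)"
    then show ?thesis by (intro exI[of _ "\<lambda>z. (- fst z, snd z)"]) (simp add: frame_def)
  qed simp
  then show ?thesis by (metis bijI')
qed

lemma ex_grid_of_extent:
  assumes "oriented A A' B B'" "W \<ge> 0" "h \<ge> 0"
  shows "\<exists>l l'. l \<ge> 1 \<and> l' \<ge> 1 \<and> highest l l' A' = lowest l l' A' + W \<and> highest l l' B' = lowest l l' B' + h"
proof (cases "A' \<in> {East, West}")
  case True
  then show ?thesis
    using oriented_cases[OF assms(1)] assms(2,3)
    by - (rule exI[of _ "nat (W + 1)"], rule exI[of _ "nat (h + 1)"], elim insertE; simp add: Suc_le_eq)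
next
  case False
  then show ?thesis
    using oriented_cases[OF assms(1)] assms(2,3)
    by - (rule exI[of _ "nat (h + 1)"], rule exI[of _ "nat (W + 1)"], elim insertE; simp add: Suc_le_eq)
qed

section \<open>Disjoint walks between the sides\<close>

definition separated_walks ::
    "cell set \<Rightarrow> nat \<Rightarrow> nat \<Rightarrow> direction \<Rightarrow> direction \<Rightarrow> direction \<Rightarrow> direction \<Rightarrow> bool" where
  "separated_walks P l l' A A' B B' \<longleftrightarrow>
     (\<exists>S S'. S \<subseteq> cells l l' \<and> S' \<subseteq> cells l l' \<and> S \<inter> S' = {} \<and>
        S \<inter> edge l l' B' = {} \<and> S' \<inter> edge l l' A' = {} \<and>
        (\<exists>a \<in> edge l l' A - corners l l'. \<exists>a' \<in> edge l l' A' \<inter> S. (a, a') \<in> (walk_rel P S)\<^sup>*) \<and>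
        (\<exists>b \<in> edge l l' B - corners l l'. \<exists>b' \<in> edge l l' B' \<inter> S'. (b, b') \<in> (walk_rel P S')\<^sup>*))"

text \<open>The two differences of the toppled sets are disjoint by construction, and the gate
  conditions place \<open>a'\<close> and \<open>b'\<close> in them and keep them off the forbidden
  sides. Only the connectivity \<open>walk\<close> depends on the kind of grid.\<close>

lemma separated_walks_of_gate:
  assumes ends: "a \<in> edge l l' A - corners l l'" "a' \<in> edge l l' A'"
      "b \<in> edge l l' B - corners l l'" "b' \<in> edge l l' B'"
    and a: "topples l l' N (add_grain c a) a'" "\<forall>u\<in>edge l l' B'. \<not> topples l l' N (add_grain c a) u"
    and b: "topples l l' N (add_grain c b) b'" "\<forall>u\<in>edge l l' A'. \<not> topples l l' N (add_grain c b) u"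
    and walk: "\<And>u. topples l l' N (add_grain c a) u \<Longrightarrow> \<not> topples l l' N (add_grain c b) u \<Longrightarrow>
      (a, u) \<in> (walk_rel P {v. topples l l' N (add_grain c a) v \<and> \<not> topples l l' N (add_grain c b) v})\<^sup>*"
      "\<And>u. topples l l' N (add_grain c b) u \<Longrightarrow> \<not> topples l l' N (add_grain c a) u \<Longrightarrow>
      (b, u) \<in> (walk_rel P {v. topples l l' N (add_grain c b) v \<and> \<not> topples l l' N (add_grain c a) v})\<^sup>*"
  shows "separated_walks P l l' A A' B B'"
proof -
  define S where "S = {v. topples l l' N (add_grain c a) v \<and> \<not> topples l l' N (add_grain c b) v}"
  define S' where "S' = {v. topples l l' N (add_grain c b) v \<and> \<not> topples l l' N (add_grain c a) v}"
  have sub: "S \<subseteq> cells l l'" "S' \<subseteq> cells l l'" by (auto simp: S_def S'_def topples_def)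
  have off: "S \<inter> S' = {}" "S \<inter> edge l l' B' = {}" "S' \<inter> edge l l' A' = {}"
    using a(2) b(2) unfolding S_def S'_def by blast+
  have "a' \<in> S" "(a, a') \<in> (walk_rel P S)\<^sup>*"
    using walk(1)[OF a(1)] a(1) b(2) ends(2) by (simp_all add: S_def)
  then have a_walk: "\<exists>a \<in> edge l l' A - corners l l'. \<exists>a' \<in> edge l l' A' \<inter> S. (a, a') \<in> (walk_rel P S)\<^sup>*"
    using ends(1,2) by (intro bexI[of _ a] bexI[of _ a'] IntI)
  have "b' \<in> S'" "(b, b') \<in> (walk_rel P S')\<^sup>*"
    using walk(2)[OF b(1)] b(1) a(2) ends(4) by (simp_all add: S'_def)
  then have b_walk: "\<exists>b \<in> edge l l' B - corners l l'. \<exists>b' \<in> edge l l' B' \<inter> S'. (b, b') \<in> (walk_rel P S')\<^sup>*"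
    using ends(3,4) by (intro bexI[of _ b] bexI[of _ b'] IntI)
  show ?thesis
    unfolding separated_walks_def
    by (rule exI[of _ S], rule exI[of _ S'], intro conjI sub off a_walk b_walk)
qed

section \<open>From disjoint walks to a weighted gate\<close>

lemma walk_map:
  assumes "(a, c) \<in> (walk_rel P S)\<^sup>*" "\<And>x y. \<phi> (x - y) = \<phi> x - \<phi> y"
  shows "(\<phi> a, \<phi> c) \<in> (walk_rel (\<phi> ` P) (\<phi> ` S))\<^sup>*"
  using assms(1)
proof (induction rule: rtrancl_induct)
  case (step c d)
  then have "(\<phi> c, \<phi> d) \<in> walk_rel (\<phi> ` P) (\<phi> ` S)"
    by (auto simp: walk_rel_def assms(2)[symmetric])
  with step.IH show ?case by simp
qed simp

lemma increasing_step:
  fixes f :: "nat \<Rightarrow> int"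
  assumes "f 0 < f m"
  shows "\<exists>k<m. f k < f (Suc k)"
  using assms
proof (induction m)
  case (Suc m)
  then show ?case by (cases "f 0 < f m") (auto intro: less_SucI)
qed simp

lemma ex_multiset_of_counts:
  assumes "finite P"
  shows "\<exists>M :: neighborhood. \<forall>r. count M r = (if r \<in> P then w r else 0)"
proof
  show "\<forall>r. count (\<Sum>p\<in>P. replicate_mset (w p) p) r = (if r \<in> P then w r else 0)"
    using assms by (simp add: count_sum)
qed

lemma admits_crossing_gate_iff:
  "admits_crossing_gate l l' N \<longleftrightarrow>
     (\<exists>c A A' B B'. oriented A A' B B' \<and> crossing_gate_wrt l l' N A A' B B' c)"
  unfolding admits_crossing_gate_def crossing_gate_def oriented_def ..

lemma route_step: "route P w m X B \<Longrightarrow> i < m \<Longrightarrow> X (Suc i) - X i \<in> P"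
  by (simp add: route_def)

text \<open>The given grid only contributes the walks; the grid of the weighted gate is a new one,
  cut to the bounding box of the routes.\<close>

lemma weighted_of_separated_walks:
  assumes fin: "finite P" and P0: "(0, 0) \<notin> P" and ori: "oriented A A' B B'"
    and sep: "separated_walks P l l' A A' B B'"
  shows "\<exists>l l' N. l \<ge> 1 \<and> l' \<ge> 1 \<and> weighted_neighborhood P N \<and> admits_crossing_gate l l' (\<lambda>_. N)"
proof -
  let ?\<phi> = "frame A' B'"
  obtain S S' a a' b b' where S: "S \<subseteq> cells l l'" "S' \<subseteq> cells l l'" "S \<inter> S' = {}"
    and a: "a \<in> edge l l' A - corners l l'" "a' \<in> edge l l' A'" "a' \<in> S" "(a, a') \<in> (walk_rel P S)\<^sup>*"
    and b: "b \<in> edge l l' B - corners l l'" "b' \<in> edge l l' B'" "b' \<in> S'" "(b, b') \<in> (walk_rel P S')\<^sup>*"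
    using sep unfolding separated_walks_def by blast
  note bij = bij_frame[OF ori]
  have inj: "inj ?\<phi>" using bij by (simp add: bij_def)
  have "\<exists>w m X n Y. (\<forall>r\<in>?\<phi> ` P. w r \<ge> 1) \<and> routes_cross (?\<phi> ` P) w m X n Y"
  proof (rule ex_routes_cross_of_walks[where S = "?\<phi> ` S" and S' = "?\<phi> ` S'" and a = "?\<phi> a"
        and a' = "?\<phi> a'" and b = "?\<phi> b" and b' = "?\<phi> b'"])
    show "finite (?\<phi> ` P)" using fin by simp
    have "?\<phi> (0, 0) = (0, 0)" by (simp add: frame_def)
    then show "(0, 0) \<notin> ?\<phi> ` P" using P0 inj by (metis inj_image_mem_iff)
    show "?\<phi> ` S \<inter> ?\<phi> ` S' = {}" using S(3) inj by (metis image_Int image_empty)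
    show "(?\<phi> a, ?\<phi> a') \<in> (walk_rel (?\<phi> ` P) (?\<phi> ` S))\<^sup>*" by (rule walk_map[OF a(4) frame_diff])
    show "(?\<phi> b, ?\<phi> b') \<in> (walk_rel (?\<phi> ` P) (?\<phi> ` S'))\<^sup>*" by (rule walk_map[OF b(4) frame_diff])
    show "lowest l l' A' \<le> fst z \<and> fst z \<le> highest l l' A' \<and> lowest l l' B' \<le> snd z \<and> snd z \<le> highest l l' B'"
      if z: "z \<in> ?\<phi> ` S \<union> ?\<phi> ` S'" for z
    proof -
      obtain x where x: "x \<in> cells l l'" "z = ?\<phi> x" using z S by blast
      then show ?thesis using cells_iff[OF ori, of x] by simp
    qed
  qed (use a b in \<open>simp_all add: non_corner_iff[OF ori] edge_iff del: Diff_iff edge.simps\<close>)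
  then obtain w m X n Y where w: "\<forall>r\<in>?\<phi> ` P. w r \<ge> 1" and rc: "routes_cross (?\<phi> ` P) w m X n Y"
    by blast
  note rcD = rc[unfolded routes_cross_def]
  have boxX: "fst (X 0) \<le> fst z \<and> fst z \<le> fst (X m) \<and> snd (Y 0) < snd z \<and> snd z < snd (Y n)"
    if "z \<in> X ` {..m}" for z using rcD that by blast
  have boxY: "snd (Y 0) \<le> snd z \<and> snd z \<le> snd (Y n) \<and> fst (X 0) < fst z \<and> fst z < fst (X m)"
    if "z \<in> Y ` {..n}" for z using rcD that by blast
  have X0: "X 0 \<in> X ` {..m}" "X m \<in> X ` {..m}" and Y0: "Y 0 \<in> Y ` {..n}" "Y n \<in> Y ` {..n}" by auto
  have ext: "fst (X 0) < fst (X m)" "snd (Y 0) < snd (Y n)" using boxX[OF X0(1)] boxY[OF Y0(1)] by linarith+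
  obtain k l' where grid: "k \<ge> 1" "l' \<ge> 1"
    "highest k l' A' = lowest k l' A' + (fst (X m) - fst (X 0))"
    "highest k l' B' = lowest k l' B' + (snd (Y n) - snd (Y 0))"
    using ex_grid_of_extent[OF ori, of "fst (X m) - fst (X 0)" "snd (Y n) - snd (Y 0)"] ext by auto
  \<comment> \<open>The translation that moves the bounding box of the routes onto the image of the
    grid in frame coordinates.\<close>
  define t where "t = (lowest k l' A' - fst (X 0), lowest k l' B' - snd (Y 0))"
  define \<theta> where "\<theta> z = inv ?\<phi> (z + t)" for z
  have \<phi>\<theta>: "?\<phi> (\<theta> z) = z + t" for z
    using bij by (simp add: \<theta>_def surj_f_inv_f bij_is_surj)
  have hA: "height A' (\<theta> z) = fst z + fst t" and hB: "height B' (\<theta> z) = snd z + snd t" for z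
    using \<phi>\<theta>[of z] by (simp_all add: frame_def prod_eq_iff)
  have bij\<theta>: "bij \<theta>"
  proof -
    have "bij (\<lambda>z. z + t)" by (intro bij_betw_byWitness[where f' = "\<lambda>z. z - t"]) auto
    then have "bij (inv ?\<phi> \<circ> (\<lambda>z. z + t))" by (intro bij_comp bij_imp_bij_inv bij)
    then show ?thesis by (simp add: \<theta>_def[abs_def] comp_def)
  qed
  have aff: "\<theta> z - r = \<theta> (z - ?\<phi> r)" for z r
  proof -
    have "?\<phi> (\<theta> z - r) = ?\<phi> (\<theta> (z - ?\<phi> r))" unfolding frame_diff \<phi>\<theta> by simp
    then show ?thesis using inj by (simp add: inj_eq)
  qed
  note tr = route_transport[OF bij\<theta> inj aff]
  have rX: "route P (w \<circ> ?\<phi>) m (\<theta> \<circ> X) ((\<theta> \<circ> Y) ` {..n})"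
    and rY: "route P (w \<circ> ?\<phi>) n (\<theta> \<circ> Y) ((\<theta> \<circ> X) ` {..m})"
    using tr rcD unfolding image_comp[symmetric] by blast+
  obtain M where M: "\<And>r. count M r = (if r \<in> P then (w \<circ> ?\<phi>) r else 0)"
    using ex_multiset_of_counts[OF fin] by blast
  have cell\<theta>: "\<theta> z \<in> cells k l' \<longleftrightarrow> fst (X 0) \<le> fst z \<and> fst z \<le> fst (X m) \<and> snd (Y 0) \<le> snd z \<and> snd z \<le> snd (Y n)" for z
    by (auto simp: cells_iff[OF ori] hA hB grid t_def)
  have X: "(\<theta> \<circ> X) ` {..m} \<subseteq> cells k l'"
  proof (rule image_subsetI)
    fix i assume "i \<in> {..m}"
    then have "X i \<in> X ` {..m}" by simp
    from boxX[OF this] show "(\<theta> \<circ> X) i \<in> cells k l'" by (simp add: cell\<theta>)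
  qed
  have Y: "(\<theta> \<circ> Y) ` {..n} \<subseteq> cells k l'"
  proof (rule image_subsetI)
    fix i assume "i \<in> {..n}"
    then have "Y i \<in> Y ` {..n}" by simp
    from boxY[OF this] show "(\<theta> \<circ> Y) i \<in> cells k l'" by (simp add: cell\<theta>)
  qed
  have offB': "u \<notin> (\<theta> \<circ> X) ` {..m}" if u: "u \<in> edge k l' B'" for u
  proof
    assume "u \<in> (\<theta> \<circ> X) ` {..m}"
    then obtain z where z: "z \<in> X ` {..m}" "u = \<theta> z"
      unfolding image_comp[symmetric] by blast
    show False using boxX[OF z(1)] u by (simp add: z(2) edge_iff hB grid t_def del: edge.simps)
  qed
  have offA': "u \<notin> (\<theta> \<circ> Y) ` {..n}" if u: "u \<in> edge k l' A'" for u
  proof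
    assume "u \<in> (\<theta> \<circ> Y) ` {..n}"
    then obtain z where z: "z \<in> Y ` {..n}" "u = \<theta> z"
      unfolding image_comp[symmetric] by blast
    show False using boxY[OF z(1)] u by (simp add: z(2) edge_iff hA grid t_def del: edge.simps)
  qed
  \<comment> \<open>Since \<open>X\<close> advances towards \<open>A'\<close> overall, one of its
    steps does. Subtracting that step from the start on side \<open>A\<close> leaves the grid, which
    guarantees that no cell topples twice.\<close>
  have "\<exists>i<m. fst (X i) < fst (X (Suc i))" using increasing_step[of "\<lambda>i. fst (X i)"] ext by simp
  then obtain i where i: "i < m" "fst (X i) < fst (X (Suc i))" by blast
  obtain r where r: "r \<in> P" "X (Suc i) - X i = ?\<phi> r"
    using route_step[OF conjunct1[OF rcD] i(1)] by blast
  have "height A' r > 0" using i(2) arg_cong[OF r(2), of fst] by simp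
  then have rb: "(\<theta> \<circ> X) 0 - r \<notin> cells k l'"
    by (auto simp: cells_iff[OF ori] hA height_diff t_def)
  have "\<exists>i<n. snd (Y i) < snd (Y (Suc i))" using increasing_step[of "\<lambda>i. snd (Y i)"] ext by simp
  then obtain j where j: "j < n" "snd (Y j) < snd (Y (Suc j))" by blast
  obtain s where s: "s \<in> P" "Y (Suc j) - Y j = ?\<phi> s"
    using route_step[OF conjunct1[OF conjunct2[OF rcD]] j(1)] by blast
  have "height B' s > 0" using j(2) arg_cong[OF s(2), of snd] by simp
  then have sb: "(\<theta> \<circ> Y) 0 - s \<notin> cells k l'"
    by (auto simp: cells_iff[OF ori] hB height_diff t_def)
  obtain c where c: "stable k l' (\<lambda>_. M) c"
    "\<And>u. topples k l' (\<lambda>_. M) (add_grain c ((\<theta> \<circ> X) 0)) u \<longleftrightarrow> u \<in> (\<theta> \<circ> X) ` {..m}"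
    "\<And>u. topples k l' (\<lambda>_. M) (add_grain c ((\<theta> \<circ> Y) 0)) u \<longleftrightarrow> u \<in> (\<theta> \<circ> Y) ` {..n}"
    using ex_config_of_routes[OF fin _ M rX X r(1) rb rY Y s(1) sb] w by auto
  have inX: "\<theta> (X 0) \<in> cells k l'" "\<theta> (X m) \<in> cells k l'" and inY: "\<theta> (Y 0) \<in> cells k l'" "\<theta> (Y n) \<in> cells k l'"
    using X Y X0 Y0 by auto
  have "crossing_gate_wrt k l' (\<lambda>_. M) A A' B B' c"
    unfolding crossing_gate_wrt_def
  proof (intro conjI bexI)
    show "stable k l' (\<lambda>_. M) c" by (rule c(1))
    show "(\<theta> \<circ> X) 0 \<in> edge k l' A - corners k l'" "(\<theta> \<circ> Y) 0 \<in> edge k l' B - corners k l'"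
      unfolding non_corner_iff[OF ori] using inX inY boxX[OF X0(1)] boxY[OF Y0(1)] by (auto simp: hA hB grid t_def)
    show "(\<theta> \<circ> X) m \<in> edge k l' A'" "(\<theta> \<circ> Y) n \<in> edge k l' B'"
      unfolding edge_iff using inX inY by (auto simp: hA hB grid t_def)
    show "topples k l' (\<lambda>_. M) (add_grain c ((\<theta> \<circ> X) 0)) ((\<theta> \<circ> X) m)"
      "topples k l' (\<lambda>_. M) (add_grain c ((\<theta> \<circ> Y) 0)) ((\<theta> \<circ> Y) n)"
      unfolding c by auto
    show "\<forall>u\<in>edge k l' B'. \<not> topples k l' (\<lambda>_. M) (add_grain c ((\<theta> \<circ> X) 0)) u"
      unfolding c using offB' by blast
    show "\<forall>u\<in>edge k l' A'. \<not> topples k l' (\<lambda>_. M) (add_grain c ((\<theta> \<circ> Y) 0)) u"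
      unfolding c using offA' by blast
  qed
  then have "admits_crossing_gate k l' (\<lambda>_. M)"
    using ori unfolding admits_crossing_gate_iff by blast
  moreover have "weighted_neighborhood P M"
    using w M unfolding weighted_neighborhood_def by (auto simp flip: count_greater_zero_iff split: if_splits)
  ultimately show ?thesis using grid(1,2) by (intro exI conjI)
qed

section \<open>Primal grids\<close>

lemma walk_start:
  assumes "(a, c) \<in> (walk_rel P S)\<^sup>*" "c \<in> S"
  shows "a \<in> S"
  using assms(1)
proof (rule converse_rtranclE)
  assume "a = c"
  then show ?thesis using assms(2) by simp
next
  fix y assume "(a, y) \<in> walk_rel P S"
  then show ?thesis by (simp add: walk_rel_def)
qed

text \<open>A shortest walk repeats no cell, because a repetition could be cut out. Injectivity
  matters since a cell of a primal grid has a single outgoing vector.\<close>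

lemma simple_walk:
  assumes "(a, c) \<in> (walk_rel P S)\<^sup>*" "a \<in> S"
  shows "\<exists>m X. X 0 = a \<and> X m = c \<and> inj_on X {..m} \<and> X ` {..m} \<subseteq> S \<and> (\<forall>k<m. X (Suc k) - X k \<in> P)"
proof -
  let ?R = "walk_rel P S"
  define m where "m = (LEAST m. (a, c) \<in> ?R ^^ m)"
  have m: "(a, c) \<in> ?R ^^ m"
    unfolding m_def using assms(1) by (metis LeastI rtrancl_imp_relpow)
  then obtain X where X: "X 0 = a" "X m = c" "\<And>i. i < m \<Longrightarrow> (X i, X (Suc i)) \<in> ?R"
    unfolding relpow_fun_conv by blast
  have reach: "(X i, X j) \<in> ?R ^^ (j - i)" if "i \<le> j" "j \<le> m" for i j
    unfolding relpow_fun_conv using that X(3) by (intro exI[of _ "\<lambda>k. X (i + k)"]) auto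
  have "X i \<noteq> X j" if ij: "i < j" "j \<le> m" for i j
  proof
    assume "X i = X j"
    then have "(a, c) \<in> ?R ^^ (i + (m - j))"
      using reach[of 0 i] reach[of j m] ij X(1,2) unfolding relpow_add by auto
    then have "m \<le> i + (m - j)" unfolding m_def by (rule Least_le)
    then show False using ij by simp
  qed
  then have inj: "inj_on X {..m}"
    unfolding inj_on_def by (metis atMost_iff linorder_neqE_nat)
  have "X i \<in> S" if "i \<le> m" for i
    using that X(3)[of "i - 1"] X(1) assms(2) by (cases i) (auto simp: walk_rel_def)
  moreover have "\<forall>k<m. X (Suc k) - X k \<in> P" using X(3) by (auto simp: walk_rel_def)
  ultimately show ?thesis using X(1,2) inj by blast
qed

text \<open>A grain that has left the grid is kept at its position outside.\<close>

definition grain_move :: "nat \<Rightarrow> nat \<Rightarrow> (cell \<Rightarrow> cell) \<Rightarrow> cell \<Rightarrow> cell" where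
  "grain_move l l' nxt x = (if x \<in> cells l l' then x + nxt x else x)"

lemma grain_move_in: "x \<in> cells l l' \<Longrightarrow> grain_move l l' nxt x = x + nxt x"
  and grain_move_out: "x \<notin> cells l l' \<Longrightarrow> grain_move l l' nxt x = x"
  by (simp_all add: grain_move_def)

text \<open>With neighborhoods of size 1 every nonempty cell is unstable, so the process is the
  motion of one grain.\<close>

lemma primal_grain:
  assumes N: "\<And>v. v \<in> cells l l' \<Longrightarrow> N v = {#nxt v#}"
    and c: "\<And>u. u \<in> cells l l' \<Longrightarrow> c u = (if u = x then 1 else 0)"
    and u: "u \<in> cells l l'"
  shows "(step l l' N ^^ t) c u = (if u = (grain_move l l' nxt ^^ t) x then 1 else 0)"
  using u
proof (induction t arbitrary: u)
  case 0
  then show ?case using c by simp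
next
  case (Suc t)
  let ?c = "(step l l' N ^^ t) c"
  define y where "y = (grain_move l l' nxt ^^ t) x"
  have IH: "?c v = (if v = y then 1 else 0)" if "v \<in> cells l l'" for v
    using Suc.IH[OF that] by (simp add: y_def)
  have "(\<Sum>v\<in>cells l l'. count (N v) (u - v) * H (int (?c v) - int (size (N v)))) =
    (\<Sum>v\<in>cells l l'. if v = y then (if u = y + nxt y then 1 else 0) else 0)"
    by (intro sum.cong) (auto simp: N IH H_def algebra_simps)
  also have "\<dots> = (if y \<in> cells l l' \<and> u = y + nxt y then 1 else 0)"
    by (simp add: sum.delta')
  finally have "(step l l' N ^^ Suc t) c u = (if y \<in> cells l l' \<and> u = y + nxt y then 1 else 0)"
    using Suc.prems by (simp add: step_def N IH H_def)
  also have "\<dots> = (if u = grain_move l l' nxt y then 1 else 0)"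
    using Suc.prems by (auto simp: grain_move_def)
  finally show ?case by (simp add: y_def)
qed

lemma topples_primal_iff:
  assumes N: "\<And>v. v \<in> cells l l' \<Longrightarrow> N v = {#nxt v#}"
    and c: "\<And>u. u \<in> cells l l' \<Longrightarrow> c u = 0"
  shows "topples l l' N (add_grain c a) u \<longleftrightarrow> u \<in> cells l l' \<and> (\<exists>t. (grain_move l l' nxt ^^ t) a = u)"
proof -
  have g: "add_grain c a v = (if v = a then 1 else 0)" if "v \<in> cells l l'" for v
    using c[OF that] by (auto simp: add_grain_def)
  have "\<not> stable_cell N ((step l l' N ^^ t) (add_grain c a)) u \<longleftrightarrow> (grain_move l l' nxt ^^ t) a = u"
    if "u \<in> cells l l'" for t
    using primal_grain[where N = N and nxt = nxt and t = t, OF N g that] N[OF that]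
    by (auto simp: stable_cell_def)
  then show ?thesis by (auto simp: topples_def)
qed

text \<open>Trajectories that meet coincide from then on. So if the second grain misses
  \<open>u\<close>, it also misses the cell from which the first grain enters
  \<open>u\<close>.\<close>

lemma primal_separated_walks:
  assumes N: "\<And>v. v \<in> cells l l' \<Longrightarrow> N v = {#nxt v#} \<and> nxt v \<in> P"
    and c: "\<And>u. u \<in> cells l l' \<Longrightarrow> c u = 0"
    and u: "topples l l' N (add_grain c a) u" "\<not> topples l l' N (add_grain c b) u"
  shows "(a, u) \<in> (walk_rel P {v. topples l l' N (add_grain c a) v \<and> \<not> topples l l' N (add_grain c b) v})\<^sup>*"
proof -
  let ?m = "grain_move l l' nxt"
  note tp = topples_primal_iff[where N = N and nxt = nxt and c = c, OF conjunct1[OF N] c]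
  obtain t where "(?m ^^ t) a = u" using u(1) tp by blast
  then show ?thesis
    using u
  proof (induction t arbitrary: u)
    case (Suc t)
    define y where "y = (?m ^^ t) a"
    have mu: "?m y = u" using Suc.prems(1) by (simp add: y_def)
    have ucell: "u \<in> cells l l'" using Suc.prems(2) tp by blast
    then have y: "y \<in> cells l l'" "u = y + nxt y" using mu by (auto simp: grain_move_def split: if_splits)
    have ya: "topples l l' N (add_grain c a) y" using tp y(1) y_def by blast
    have yb: "\<not> topples l l' N (add_grain c b) y"
    proof
      assume "topples l l' N (add_grain c b) y"
      then obtain s where "(?m ^^ s) b = y" using tp by blast
      then have "(?m ^^ Suc s) b = u" using mu by simp
      then show False using Suc.prems(3) tp ucell by blast
    qed
    have "(a, y) \<in> (walk_rel P {v. topples l l' N (add_grain c a) v \<and> \<not> topples l l' N (add_grain c b) v})\<^sup>*"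
      using Suc.IH ya yb y_def by blast
    moreover have "(y, u) \<in> walk_rel P {v. topples l l' N (add_grain c a) v \<and> \<not> topples l l' N (add_grain c b) v}"
      using ya yb Suc.prems N[OF y(1)] y(2) by (simp add: walk_rel_def)
    ultimately show ?case by (rule rtrancl_into_rtrancl)
  qed simp
qed

section \<open>Walks from a gate on a uniform grid\<close>

lemma add_grain_other: "u \<noteq> a \<Longrightarrow> add_grain c a u = c u"
  by (simp add: add_grain_def)

text \<open>
  If every cell that helped \<open>u\<close> to topple in the first process also toppled in the second one,
  then \<open>u\<close> would receive enough grains in the second process as well.
\<close>

lemma uniform_separated_walks:
  assumes MP: "set_mset M \<subseteq> P"
    and bound: "\<And>u. u \<in> cells l l' \<Longrightarrow> add_grain c a u + (\<Sum>v\<in>cells l l'. count M (u - v)) < 2 * size M"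
      "\<And>u. u \<in> cells l l' \<Longrightarrow> add_grain c b u + (\<Sum>v\<in>cells l l'. count M (u - v)) < 2 * size M"
    and u: "topples l l' (\<lambda>_. M) (add_grain c a) u" "\<not> topples l l' (\<lambda>_. M) (add_grain c b) u"
  shows "(a, u) \<in> (walk_rel P {v. topples l l' (\<lambda>_. M) (add_grain c a) v \<and>
    \<not> topples l l' (\<lambda>_. M) (add_grain c b) v})\<^sup>*"
proof -
  let ?N = "\<lambda>_::cell. M"
  let ?Ta = "toppled l l' ?N (add_grain c a)" and ?Tb = "toppled l l' ?N (add_grain c b)"
  define S where "S = {v. topples l l' ?N (add_grain c a) v \<and> \<not> topples l l' ?N (add_grain c b) v}"
  obtain t where "u \<in> ?Ta t" using u(1) topples_iff by blast
  then have "(a, u) \<in> (walk_rel P S)\<^sup>*"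
    using u(2)
  proof (induction t arbitrary: u)
    case (Suc t)
    show ?case
    proof (cases "u \<in> ?Ta t \<or> u = a")
      case True
      then show ?thesis using Suc.IH[OF _ Suc.prems(2)] by (elim disjE) simp_all
    next
      case False
      have ucell: "u \<in> cells l l'" using Suc.prems(1) toppled_subset by blast
      have "\<not> stable_cell ?N ((step l l' ?N ^^ t) (add_grain c a)) u"
        using Suc.prems(1) False by (simp add: toppled_Suc)
      then have full: "c u + (\<Sum>v\<in>?Ta t. count M (u - v)) \<ge> size M"
        using uniform_grains[OF bound(1) ucell, of t] False add_grain_other[of u a c]
        by (simp add: stable_cell_def)
      have "\<exists>v\<in>?Ta t. \<not> topples l l' ?N (add_grain c b) v \<and> count M (u - v) > 0"
      proof (rule ccontr)
        assume neg: "\<not> ?thesis"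
        have "\<forall>v\<in>{v \<in> ?Ta t. count M (u - v) > 0}. \<exists>s. v \<in> ?Tb s"
          using neg topples_iff by blast
        then obtain \<tau> where \<tau>: "\<And>v. v \<in> ?Ta t \<Longrightarrow> count M (u - v) > 0 \<Longrightarrow> v \<in> ?Tb (\<tau> v)"
          by (metis (mono_tags, lifting) mem_Collect_eq)
        \<comment> \<open>The sum of the toppling times is a common upper bound for them.\<close>
        define s where "s = (\<Sum>v\<in>?Ta t. \<tau> v)"
        have s: "v \<in> ?Tb s" if "v \<in> ?Ta t" "count M (u - v) > 0" for v
        proof -
          have "\<tau> v \<le> s" unfolding s_def by (rule member_le_sum[OF that(1)]) simp_all
          then show ?thesis using \<tau>[OF that] toppled_mono by blast
        qed
        have "(\<Sum>v\<in>?Ta t. count M (u - v)) = (\<Sum>v | v \<in> ?Ta t \<and> count M (u - v) > 0. count M (u - v))"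
          by (intro sum.mono_neutral_right) auto
        also have "\<dots> \<le> (\<Sum>v\<in>?Tb s. count M (u - v))"
          using s by (intro sum_mono2) auto
        finally have "c u + (\<Sum>v\<in>?Tb s. count M (u - v)) \<ge> size M" using full by linarith
        moreover have "u \<notin> ?Tb s" using Suc.prems(2) topples_iff by blast
        moreover have "add_grain c b u \<ge> c u" by (simp add: add_grain_def)
        ultimately have "(step l l' ?N ^^ s) (add_grain c b) u \<ge> size M"
          using uniform_grains[OF bound(2) ucell, of s] by simp
        then have "u \<in> ?Tb (Suc s)" using ucell by (simp add: toppled_Suc stable_cell_def)
        then show False using Suc.prems(2) topples_iff by blast
      qed
      then obtain v where v: "v \<in> ?Ta t" "\<not> topples l l' ?N (add_grain c b) v" "count M (u - v) > 0" by blast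
      have "(a, v) \<in> (walk_rel P S)\<^sup>*" using Suc.IH v by blast
      moreover have "v \<in> S" "u \<in> S" using v Suc.prems topples_iff unfolding S_def by blast+
      moreover have "u - v \<in> P" using v(3) MP by (auto simp: count_greater_zero_iff)
      ultimately show ?thesis by (auto simp: walk_rel_def intro: rtrancl_into_rtrancl)
    qed
  qed simp
  then show ?thesis unfolding S_def .
qed

text \<open>If no vector pointed upwards, the cells above \<open>a\<close> would never gain a grain.
  The vector found here leads backwards from a start on the border out of the grid, as
  \<open>add_grain_bound\<close> demands.\<close>

lemma topples_upwards:
  assumes st: "stable l l' (\<lambda>_. M) c"
    and tp: "topples l l' (\<lambda>_. M) (add_grain c a) u" and up: "height D a < height D u"
  shows "\<exists>r\<in>#M. height D r > 0"
proof (rule ccontr)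
  assume "\<not> ?thesis"
  then have down: "height D r \<le> 0" if "r \<in># M" for r using that by (meson not_le)
  let ?s = "step l l' (\<lambda>_. M)"
  have inv: "(?s ^^ t) (add_grain c a) v \<le> c v" if "v \<in> cells l l'" "height D a < height D v" for t v
    using that
  proof (induction t arbitrary: v)
    case 0
    then show ?case by (auto simp: add_grain_def)
  next
    case (Suc t)
    let ?c = "(?s ^^ t) (add_grain c a)"
    have "count M (v - x) = 0" if x: "x \<in> cells l l'" "\<not> stable_cell (\<lambda>_. M) ?c x" for x
    proof -
      have "height D x \<le> height D a"
      proof (rule ccontr)
        assume "\<not> ?thesis"
        then have "?c x \<le> c x" using Suc.IH x(1) by simp
        also have "c x < size M" using st x(1) by (simp add: stable_def stable_cell_def)
        finally show False using x(2) by (simp add: stable_cell_def)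
      qed
      then have "height D (v - x) > 0" using Suc.prems(2) by (simp add: height_diff)
      then show ?thesis using down by (meson count_inI not_le)
    qed
    then have "(?s ^^ Suc t) (add_grain c a) v \<le> ?c v"
      using step_uniform[OF Suc.prems(1), of M ?c] by simp
    also have "\<dots> \<le> c v" using Suc.IH[OF Suc.prems] .
    finally show ?case .
  qed
  obtain t where t: "u \<in> cells l l'" "\<not> stable_cell (\<lambda>_. M) ((?s ^^ t) (add_grain c a)) u"
    using tp unfolding topples_def by blast
  have "c u < size M" using st t(1) by (simp add: stable_def stable_cell_def)
  then show False using inv[OF t(1) up, of t] t(2) by (simp add: stable_cell_def)
qed

lemma separated_walks_of_uniform:
  assumes MP: "set_mset M \<subseteq> P" and ori: "oriented A A' B B'"
    and gate: "crossing_gate_wrt l l' (\<lambda>_. M) A A' B B' c"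
  shows "separated_walks P l l' A A' B B'"
proof -
  obtain a a' b b' where st: "stable l l' (\<lambda>_. M) c"
    and ends: "a \<in> edge l l' A - corners l l'" "a' \<in> edge l l' A'"
      "b \<in> edge l l' B - corners l l'" "b' \<in> edge l l' B'"
    and a: "topples l l' (\<lambda>_. M) (add_grain c a) a'" "\<forall>u\<in>edge l l' B'. \<not> topples l l' (\<lambda>_. M) (add_grain c a) u"
    and b: "topples l l' (\<lambda>_. M) (add_grain c b) b'" "\<forall>u\<in>edge l l' A'. \<not> topples l l' (\<lambda>_. M) (add_grain c b) u"
    using gate unfolding crossing_gate_wrt_def by blast
  note na = ends(1)[unfolded non_corner_iff[OF ori]] and nb = ends(3)[unfolded non_corner_iff[OF ori]]
  note ea = ends(2)[unfolded edge_iff] and eb = ends(4)[unfolded edge_iff]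
  have "height A' a < height A' a'" using na nb ea by linarith
  then obtain r where r: "r \<in># M" "height A' r > 0" using topples_upwards[OF st a(1)] by blast
  have ra: "a - r \<notin> cells l l'" using na r(2) by (simp add: cells_iff[OF ori] height_diff)
  have "height B' b < height B' b'" using na nb eb by linarith
  then obtain s where s: "s \<in># M" "height B' s > 0" using topples_upwards[OF st b(1)] by blast
  have sb: "b - s \<notin> cells l l'" using nb s(2) by (simp add: cells_iff[OF ori] height_diff)
  note bounds = add_grain_bound[OF st r(1) ra] add_grain_bound[OF st s(1) sb]
  show ?thesis
    by (rule separated_walks_of_gate[OF ends a b])
      (rule uniform_separated_walks[OF MP bounds], assumption+,
       rule uniform_separated_walks[OF MP bounds(2) bounds(1)], assumption+)
qed

section \<open>Primal gates and disjoint walks\<close>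

lemma separated_walks_of_primal:
  assumes prim: "primal_nonuniform P l l' N" and gate: "crossing_gate_wrt l l' N A A' B B' c"
  shows "separated_walks P l l' A A' B B'"
proof -
  obtain a a' b b' where st: "stable l l' N c"
    and ends: "a \<in> edge l l' A - corners l l'" "a' \<in> edge l l' A'"
      "b \<in> edge l l' B - corners l l'" "b' \<in> edge l l' B'"
    and a: "topples l l' N (add_grain c a) a'" "\<forall>u\<in>edge l l' B'. \<not> topples l l' N (add_grain c a) u"
    and b: "topples l l' N (add_grain c b) b'" "\<forall>u\<in>edge l l' A'. \<not> topples l l' N (add_grain c b) u"
    using gate unfolding crossing_gate_wrt_def by blast
  have one: "set_mset (N v) \<subseteq> P \<and> size (N v) = 1" if "v \<in> cells l l'" for v
    using prim that by (simp add: primal_nonuniform_def)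
  have "\<exists>x. N v = {#x#} \<and> x \<in> P" if "v \<in> cells l l'" for v
    using one[OF that] by (metis insert_subset set_mset_add_mset_insert size_1_singleton_mset)
  then obtain nxt where nxt: "\<And>v. v \<in> cells l l' \<Longrightarrow> N v = {#nxt v#} \<and> nxt v \<in> P" by metis
  have c: "c u = 0" if "u \<in> cells l l'" for u
    using st one that by (auto simp: stable_def stable_cell_def)
  show ?thesis
    by (rule separated_walks_of_gate[OF ends a b])
      (rule primal_separated_walks[OF nxt c], assumption+,
       rule primal_separated_walks[OF nxt c], assumption+)
qed

text \<open>The grain follows the walk and by \<open>out\<close> then drops off the grid, so nothing
  beyond the walk topples.\<close>

lemma primal_walk_carries:
  assumes N: "\<And>v. v \<in> cells l l' \<Longrightarrow> N v = {#nxt v#}"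
    and X: "X ` {..m} \<subseteq> cells l l'" "\<And>k. k < m \<Longrightarrow> nxt (X k) = X (Suc k) - X k"
    and out: "X m + nxt (X m) \<notin> cells l l'"
  shows "topples l l' N (add_grain (\<lambda>_. 0) (X 0)) u \<longleftrightarrow> u \<in> X ` {..m}"
proof -
  let ?m = "grain_move l l' nxt"
  note tp = topples_primal_iff[where N = N and nxt = nxt and c = "\<lambda>_. 0" and a = "X 0", OF N refl]
  have path: "(?m ^^ k) (X 0) = X k" if "k \<le> m" for k
    using that
  proof (induction k)
    case (Suc k)
    then have "X k \<in> cells l l'" using X(1) by auto
    then show ?case using Suc X(2)[of k] by (simp add: grain_move_in)
  qed simp
  have after: "(?m ^^ (Suc m + k)) (X 0) = X m + nxt (X m)" for k
  proof (induction k)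
    case 0
    have "X m \<in> cells l l'" using X(1) by auto
    then show ?case using path[of m] by (simp add: grain_move_in)
  next
    case (Suc k)
    then show ?case using out by (simp add: grain_move_out)
  qed
  show ?thesis
  proof
    assume "topples l l' N (add_grain (\<lambda>_. 0) (X 0)) u"
    then obtain t where t: "u \<in> cells l l'" "(?m ^^ t) (X 0) = u" using tp by blast
    have "t \<le> m"
    proof (rule ccontr)
      assume "\<not> t \<le> m"
      then obtain k where "t = Suc m + k" using less_imp_add_positive by (metis Suc_leI le_Suc_ex not_le)
      then show False using after t out by metis
    qed
    then show "u \<in> X ` {..m}" using path t(2) by auto
  next
    assume "u \<in> X ` {..m}"
    then show "topples l l' N (add_grain (\<lambda>_. 0) (X 0)) u" using tp path X(1) by blast
  qed
qed

lemma ex_upward_step: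
  assumes "\<forall>k<m. X (Suc k) - X k \<in> P" "height D (X 0) < height D (X m)"
  shows "\<exists>r\<in>P. height D r > 0"
proof -
  obtain k where k: "k < m" "height D (X k) < height D (X (Suc k))"
    using increasing_step[of "\<lambda>k. height D (X k)" m] assms(2) by blast
  then have "height D (X (Suc k) - X k) > 0" by (simp add: height_diff)
  then show ?thesis using assms(1) k(1) by blast
qed

lemma primal_of_separated_walks:
  assumes ori: "oriented A A' B B'" and sep: "separated_walks P l l' A A' B B'"
  shows "\<exists>N. primal_nonuniform P l l' N \<and> admits_crossing_gate l l' N"
proof -
  obtain S S' a a' b b' where S: "S \<subseteq> cells l l'" "S' \<subseteq> cells l l'" "S \<inter> S' = {}"
      "S \<inter> edge l l' B' = {}" "S' \<inter> edge l l' A' = {}"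
    and a: "a \<in> edge l l' A - corners l l'" "a' \<in> edge l l' A'" "a' \<in> S" "(a, a') \<in> (walk_rel P S)\<^sup>*"
    and b: "b \<in> edge l l' B - corners l l'" "b' \<in> edge l l' B'" "b' \<in> S'" "(b, b') \<in> (walk_rel P S')\<^sup>*"
    using sep unfolding separated_walks_def by blast
  note na = a(1)[unfolded non_corner_iff[OF ori]] and nb = b(1)[unfolded non_corner_iff[OF ori]]
  note ea = a(2)[unfolded edge_iff] and eb = b(2)[unfolded edge_iff]
  have hA: "height A' a < height A' a'" using na nb ea by linarith
  have hB: "height B' b < height B' b'" using na nb eb by linarith
  have "a \<in> S" by (rule walk_start[OF a(4,3)])
  then obtain m X where X: "X 0 = a" "X m = a'" "inj_on X {..m}" "X ` {..m} \<subseteq> S" "\<forall>k<m. X (Suc k) - X k \<in> P"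
    using simple_walk[OF a(4)] by blast
  have "b \<in> S'" by (rule walk_start[OF b(4,3)])
  then obtain n Y where Y: "Y 0 = b" "Y n = b'" "inj_on Y {..n}" "Y ` {..n} \<subseteq> S'" "\<forall>k<n. Y (Suc k) - Y k \<in> P"
    using simple_walk[OF b(4)] by blast
  obtain r where r: "r \<in> P" "height A' r > 0" using ex_upward_step[OF X(5)] hA X(1,2) by blast
  obtain s where s: "s \<in> P" "height B' s > 0" using ex_upward_step[OF Y(5)] hB Y(1,2) by blast
  define along where "along Z n e v = (let k = the_inv_into {..n} Z v in if k < n then Z (Suc k) - Z k else e)"
    for Z :: "nat \<Rightarrow> cell" and n and e v
  \<comment> \<open>The last cell of each walk gets a vector towards its target side, so that the
    grain drops out there. Cells off both walks are never reached and get \<open>r\<close> as a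
    default from \<open>P\<close>.\<close>
  define nxt where "nxt v = (if v \<in> X ` {..m} then along X m r v else if v \<in> Y ` {..n} then along Y n s v else r)" for v
  define N where "N v = {#nxt v#}" for v
  have along: "along Z n e (Z k) = (if k < n then Z (Suc k) - Z k else e)" if "inj_on Z {..n}" "k \<le> n" for Z n e k
    using the_inv_into_f_f[OF that(1), of k] that(2) by (simp add: along_def)
  have nX: "nxt (X k) = (if k < m then X (Suc k) - X k else r)" if "k \<le> m" for k
    using along[OF X(3) that] that by (simp add: nxt_def)
  have nY: "nxt (Y k) = (if k < n then Y (Suc k) - Y k else s)" if "k \<le> n" for k
  proof -
    have "Y k \<notin> X ` {..m}" using X(4) Y(4) S(3) that by blast
    then show ?thesis using along[OF Y(3) that] that by (simp add: nxt_def)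
  qed
  have nP: "nxt v \<in> P" for v
  proof -
    consider "v \<in> X ` {..m}" | "v \<in> Y ` {..n}" | "v \<notin> X ` {..m}" "v \<notin> Y ` {..n}" by blast
    then show ?thesis
    proof cases
      case 1
      then obtain k where "k \<le> m" "v = X k" by blast
      then show ?thesis using nX[of k] X(5) r(1) by simp
    next
      case 2
      then obtain k where "k \<le> n" "v = Y k" by blast
      then show ?thesis using nY[of k] Y(5) s(1) by simp
    next
      case 3
      then show ?thesis using r(1) by (simp only: nxt_def if_False)
    qed
  qed
  have tX: "topples l l' N (add_grain (\<lambda>_. 0) a) u \<longleftrightarrow> u \<in> X ` {..m}" for u
    unfolding X(1)[symmetric]
  proof (rule primal_walk_carries)
    show "X ` {..m} \<subseteq> cells l l'" using X(4) S(1) by blast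
    show "X m + nxt (X m) \<notin> cells l l'"
      using nX[of m] r(2) ea X(2) by (simp add: cells_iff[OF ori] height_add)
  qed (simp_all add: N_def nX)
  have tY: "topples l l' N (add_grain (\<lambda>_. 0) b) u \<longleftrightarrow> u \<in> Y ` {..n}" for u
    unfolding Y(1)[symmetric]
  proof (rule primal_walk_carries)
    show "Y ` {..n} \<subseteq> cells l l'" using Y(4) S(2) by blast
    show "Y n + nxt (Y n) \<notin> cells l l'"
      using nY[of n] s(2) eb Y(2) by (simp add: cells_iff[OF ori] height_add)
  qed (simp_all add: N_def nY)
  have "crossing_gate_wrt l l' N A A' B B' (\<lambda>_. 0)"
    unfolding crossing_gate_wrt_def
  proof (intro conjI bexI)
    show "stable l l' N (\<lambda>_. 0)" by (simp add: stable_def stable_cell_def N_def)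
    show "a \<in> edge l l' A - corners l l'" "a' \<in> edge l l' A'" "b \<in> edge l l' B - corners l l'" "b' \<in> edge l l' B'"
      by (fact a b)+
    show "topples l l' N (add_grain (\<lambda>_. 0) a) a'" unfolding tX using X(2) by blast
    show "topples l l' N (add_grain (\<lambda>_. 0) b) b'" unfolding tY using Y(2) by blast
    show "\<forall>u\<in>edge l l' B'. \<not> topples l l' N (add_grain (\<lambda>_. 0) a) u" unfolding tX using X(4) S(4) by blast
    show "\<forall>u\<in>edge l l' A'. \<not> topples l l' N (add_grain (\<lambda>_. 0) b) u" unfolding tY using Y(4) S(5) by blast
  qed
  then have "admits_crossing_gate l l' N" using ori unfolding admits_crossing_gate_iff by blast
  moreover have "primal_nonuniform P l l' N" using nP by (simp add: primal_nonuniform_def N_def)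
  ultimately show ?thesis by blast
qed

section \<open>Equivalence\<close>

theorem theorem1:
  fixes P :: "(int \<times> int) set"
  assumes "finite P" and "P \<subseteq> UNIV - {(0, 0)}"
  shows "(\<exists>l l' N. l \<ge> 1 \<and> l' \<ge> 1 \<and> primal_nonuniform P l l' N \<and> admits_crossing_gate l l' N)
     \<longleftrightarrow> (\<exists>l l' N. l \<ge> 1 \<and> l' \<ge> 1 \<and> weighted_neighborhood P N
              \<and> admits_crossing_gate l l' (\<lambda>_. N))"
proof
  assume "\<exists>l l' N. l \<ge> 1 \<and> l' \<ge> 1 \<and> primal_nonuniform P l l' N \<and> admits_crossing_gate l l' N"
  then obtain l l' N where N: "primal_nonuniform P l l' N" "admits_crossing_gate l l' N" by blast
  from N(2) obtain A A' B B' c where ori: "oriented A A' B B'" and gate: "crossing_gate_wrt l l' N A A' B B' c"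
    unfolding admits_crossing_gate_iff by blast
  have "(0, 0) \<notin> P" using assms(2) by blast
  from weighted_of_separated_walks[OF assms(1) this ori separated_walks_of_primal[OF N(1) gate]]
  show "\<exists>l l' N. l \<ge> 1 \<and> l' \<ge> 1 \<and> weighted_neighborhood P N \<and> admits_crossing_gate l l' (\<lambda>_. N)" .
next
  assume "\<exists>l l' N. l \<ge> 1 \<and> l' \<ge> 1 \<and> weighted_neighborhood P N \<and> admits_crossing_gate l l' (\<lambda>_. N)"
  then obtain l l' N where l: "l \<ge> 1" "l' \<ge> 1"
    and N: "weighted_neighborhood P N" "admits_crossing_gate l l' (\<lambda>_. N)" by blast
  have NP: "set_mset N \<subseteq> P" using N(1) by (simp add: weighted_neighborhood_def)
  from N(2) obtain A A' B B' c where ori: "oriented A A' B B'"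
    and gate: "crossing_gate_wrt l l' (\<lambda>_. N) A A' B B' c"
    unfolding admits_crossing_gate_iff by blast
  from primal_of_separated_walks[OF ori separated_walks_of_uniform[OF NP ori gate]]
  show "\<exists>l l' N. l \<ge> 1 \<and> l' \<ge> 1 \<and> primal_nonuniform P l l' N \<and> admits_crossing_gate l l' N"
    using l by blast
qed

end
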